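(* Let $(X,Y)$ and $(V,W)$ be two Banach couples with $\operatorname{Int}_1(X,Y)=\operatorname{Int}_1(V,W)$. Then $(X,Y)\cong(V,W)$, i.e. either ($X\cong V$ and $Y\cong W$) or ($X\cong W$ and $Y\cong V$).
   Context: All Banach spaces are over the same scalar field ($\mathbb{R}$ or $\mathbb{C}$). $E\hookrightarrow F$ means that the Banach space $E$ is a linear subspace of the Banach space $F$ and the inclusion is continuous. $E\cong F$ means that $E$ and $F$ coincide as linear spaces and their norms are proportional (one is a positive constant multiple of the other). A Banach couple $(X,Y)$ is a pair of Banach spaces, both linearly and continuously embedded (as linear subspaces) in some Hausdorff topological vector space. $X\cap Y$ is a Banach space with norm $\|z\|_{X\cap Y}=\max\{\|z\|_X,\|z\|_Y\}$, and $X+Y$ is a Banach space with norm $\|z\|_{X+Y}=\inf\{\|x\|_X+\|y\|_Y: x\in X,\ y\in Y,\ z=x+y\}$. $\operatorname{I}(X,Y)$ is the collection of intermediate spaces, i.e. Banach spaces $Z$ with $X\cap Y\hookrightarrow Z\hookrightarrow X+Y$. $L((X,Y))$ is the set of linear operators $T$ in $X+Y$ that map $X$ into $X$ and $Y$ into $Y$ boundedly, with norm $\|T\|_{L((X,Y))}=\max\{\|T\|_{X\to X},\|T\|_{Y\to Y}\}$. $\operatorname{Int}_1(X,Y)$ (exact interpolation spaces) is the collection of all $Z\in\operatorname{I}(X,Y)$ such that for every $T\in L((X,Y))$ one has $T(Z)\subset Z$ and $\|T\|_{Z\to Z}\le\|T\|_{L((X,Y))}$. *)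

theory Defs
  imports "HOL-Analysis.Analysis"
begin

text \<open>
  All linear spaces are linear subspaces of a vector space \<open>'a\<close> (a purely algebraic universe,
  carrying no topology) with scalar multiplication \<open>s\<close> over \<open>'k\<close>. A normed space is a linear
  subspace together with its own norm. Norms are required to vanish off the carrier, so that
  equality of records is equality of normed spaces and collections of spaces can be compared
  as sets.
\<close>

record 'a nspace =
  space_of :: "'a set"
  norm_of :: "'a \<Rightarrow> real"

definition norm_top :: "'a::ab_group_add nspace \<Rightarrow> 'a topology" where
  "norm_top E = Metric_space.mtopology (space_of E) (\<lambda>x y. norm_of E (x - y))"

definition normed_space :: "('k::real_normed_field \<Rightarrow> 'a::ab_group_add \<Rightarrow> 'a) \<Rightarrow> 'a nspace \<Rightarrow> bool" where
  "normed_space s E \<longleftrightarrow>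
     module.subspace s (space_of E) \<and>
     (\<forall>x\<in>space_of E. 0 \<le> norm_of E x) \<and>
     (\<forall>x\<in>space_of E. norm_of E x = 0 \<longleftrightarrow> x = 0) \<and>
     (\<forall>x\<in>space_of E. \<forall>y\<in>space_of E. norm_of E (x + y) \<le> norm_of E x + norm_of E y) \<and>
     (\<forall>c. \<forall>x\<in>space_of E. norm_of E (s c x) = norm c * norm_of E x) \<and>
     (\<forall>x. x \<notin> space_of E \<longrightarrow> norm_of E x = 0)"

definition banach_space :: "('k::real_normed_field \<Rightarrow> 'a::ab_group_add \<Rightarrow> 'a) \<Rightarrow> 'a nspace \<Rightarrow> bool" where
  "banach_space s E \<longleftrightarrow>
     normed_space s E \<and>
     Metric_space.mcomplete (space_of E) (\<lambda>x y. norm_of E (x - y))"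

definition cont_embedded :: "'a::ab_group_add nspace \<Rightarrow> 'a nspace \<Rightarrow> bool"  (infix "\<hookrightarrow>" 50) where
  "E \<hookrightarrow> F \<longleftrightarrow> space_of E \<subseteq> space_of F \<and> continuous_map (norm_top E) (norm_top F) id"

definition norm_proportional :: "'a nspace \<Rightarrow> 'a nspace \<Rightarrow> bool"  (infix "\<cong>\<^sub>n" 50) where
  "E \<cong>\<^sub>n F \<longleftrightarrow>
     space_of E = space_of F \<and>
     (\<exists>c>0. \<forall>x\<in>space_of E. norm_of E x = c * norm_of F x)"

text \<open>The underlying linear space of the topological vector space is \<open>topspace A\<close>.\<close>

definition hausdorff_tvs :: "('k::real_normed_field \<Rightarrow> 'a::ab_group_add \<Rightarrow> 'a) \<Rightarrow> 'a topology \<Rightarrow> bool" where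
  "hausdorff_tvs s A \<longleftrightarrow>
     module.subspace s (topspace A) \<and>
     Hausdorff_space A \<and>
     continuous_map (prod_topology A A) A (\<lambda>(x, y). x + y) \<and>
     continuous_map (prod_topology euclidean A) A (\<lambda>(c, x). s c x)"

definition banach_couple :: "('k::real_normed_field \<Rightarrow> 'a::ab_group_add \<Rightarrow> 'a) \<Rightarrow> 'a nspace \<Rightarrow> 'a nspace \<Rightarrow> bool" where
  "banach_couple s X Y \<longleftrightarrow>
     banach_space s X \<and> banach_space s Y \<and>
     (\<exists>A. hausdorff_tvs s A \<and>
          space_of X \<subseteq> topspace A \<and> continuous_map (norm_top X) A id \<and>
          space_of Y \<subseteq> topspace A \<and> continuous_map (norm_top Y) A id)"

definition couple_inter :: "'a nspace \<Rightarrow> 'a nspace \<Rightarrow> 'a nspace" where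
  "couple_inter X Y =
     \<lparr>space_of = space_of X \<inter> space_of Y,
      norm_of = (\<lambda>z. if z \<in> space_of X \<inter> space_of Y then max (norm_of X z) (norm_of Y z) else 0)\<rparr>"

definition couple_sum :: "'a::ab_group_add nspace \<Rightarrow> 'a nspace \<Rightarrow> 'a nspace" where
  "couple_sum X Y =
     \<lparr>space_of = {x + y |x y. x \<in> space_of X \<and> y \<in> space_of Y},
      norm_of = (\<lambda>z. if z \<in> {x + y |x y. x \<in> space_of X \<and> y \<in> space_of Y}
                     then Inf {norm_of X x + norm_of Y y |x y. x \<in> space_of X \<and> y \<in> space_of Y \<and> z = x + y}
                     else 0)\<rparr>"

definition intermediate_spaces ::
  "('k::real_normed_field \<Rightarrow> 'a::ab_group_add \<Rightarrow> 'a) \<Rightarrow> 'a nspace \<Rightarrow> 'a nspace \<Rightarrow> 'a nspace set" where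
  "intermediate_spaces s X Y =
     {Z. banach_space s Z \<and> couple_inter X Y \<hookrightarrow> Z \<and> Z \<hookrightarrow> couple_sum X Y}"

definition linear_op_on ::
  "('k::real_normed_field \<Rightarrow> 'a::ab_group_add \<Rightarrow> 'a) \<Rightarrow> 'a set \<Rightarrow> ('a \<Rightarrow> 'a) \<Rightarrow> bool" where
  "linear_op_on s S T \<longleftrightarrow>
     T ` S \<subseteq> S \<and>
     (\<forall>x\<in>S. \<forall>y\<in>S. T (x + y) = T x + T y) \<and>
     (\<forall>c. \<forall>x\<in>S. T (s c x) = s c (T x))"

definition maps_boundedly :: "'a nspace \<Rightarrow> ('a \<Rightarrow> 'a) \<Rightarrow> bool" where
  "maps_boundedly E T \<longleftrightarrow>
     T ` space_of E \<subseteq> space_of E \<and>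
     (\<exists>C. \<forall>x\<in>space_of E. norm_of E (T x) \<le> C * norm_of E x)"

text \<open>The operator norm on \<open>E\<close>; meaningful only under \<^const>\<open>maps_boundedly\<close>.\<close>

definition op_norm :: "'a nspace \<Rightarrow> ('a \<Rightarrow> 'a) \<Rightarrow> real" where
  "op_norm E T = Sup {norm_of E (T x) |x. x \<in> space_of E \<and> norm_of E x \<le> 1}"

text \<open>Operators are total functions on \<open>'a\<close>; their values off \<open>X + Y\<close> are irrelevant.\<close>

definition couple_ops ::
  "('k::real_normed_field \<Rightarrow> 'a::ab_group_add \<Rightarrow> 'a) \<Rightarrow> 'a nspace \<Rightarrow> 'a nspace \<Rightarrow> ('a \<Rightarrow> 'a) set" where
  "couple_ops s X Y =
     {T. linear_op_on s (space_of (couple_sum X Y)) T \<and> maps_boundedly X T \<and> maps_boundedly Y T}"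

definition couple_op_norm :: "'a nspace \<Rightarrow> 'a nspace \<Rightarrow> ('a \<Rightarrow> 'a) \<Rightarrow> real" where
  "couple_op_norm X Y T = max (op_norm X T) (op_norm Y T)"

text \<open>
  Boundedness on \<open>Z\<close> is stated explicitly because the real-valued \<^const>\<open>op_norm\<close> cannot express
  that an operator norm is finite.
\<close>

definition Int1 ::
  "('k::real_normed_field \<Rightarrow> 'a::ab_group_add \<Rightarrow> 'a) \<Rightarrow> 'a nspace \<Rightarrow> 'a nspace \<Rightarrow> 'a nspace set" where
  "Int1 s X Y =
     {Z \<in> intermediate_spaces s X Y.
        \<forall>T\<in>couple_ops s X Y. maps_boundedly Z T \<and> op_norm Z T \<le> couple_op_norm X Y T}"

end

theory Submission
  imports Defs
begin

text \<open>
  Write \<open>|z|\<^sub>E\<close> for the norm of \<open>z\<close> in \<open>E\<close>, and \<open>|f|\<^sub>E\<close> for the dual norm on \<open>E\<close> of a functional \<open>f\<close> on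
  \<open>X + Y\<close>. The spaces \<open>X\<close> and \<open>Y\<close> are exact interpolation spaces of \<open>(X, Y)\<close>, hence of \<open>(V, W)\<close>, and
  conversely. So \<open>X + Y = V + W\<close> and \<open>X \<inter> Y = V \<inter> W\<close> as sets, and the couples have the same bounded
  operators with the same norms. Only rank one operators \<open>w \<mapsto> f w z\<close> are needed. For \<open>z \<in> X \<inter> Y\<close> and
  \<open>f\<close> bounded on \<open>X\<close> and \<open>Y\<close>, they give the identity (\<open>rank_one_transfer\<close>)
  \<open>max (|f|\<^sub>X |z|\<^sub>X) (|f|\<^sub>Y |z|\<^sub>Y) = max (|f|\<^sub>V |z|\<^sub>V) (|f|\<^sub>W |z|\<^sub>W)\<close>.

  \<^emph>\<open>The norms on the intersection.\<close> Let \<open>f\<close> vary so that the ratio \<open>|f|\<^sub>X / |f|\<^sub>Y\<close> tends to its infimum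
  \<open>I\<close>. A duality argument in the style of the open mapping theorem shows \<open>I |z|\<^sub>X \<le> |z|\<^sub>Y\<close> on the
  intersection (\<open>norm_le_of_dual_norm_le\<close>). So in the limit the left side becomes a multiple of \<open>|z|\<^sub>Y\<close>, and
  \<open>|z|\<^sub>Y = max (p |z|\<^sub>V) (q |z|\<^sub>W)\<close> with constants \<open>p\<close> and \<open>q\<close> (\<open>right_norm_is_max\<close>). By symmetry each of the
  four norms is such a maximum of the two norms of the other couple. By elementary
  algebra, four positive functions related in this way are proportional in pairs
  (\<open>matching_of_mutual_max\<close>).

  \<^emph>\<open>From the intersection to the spaces.\<close> If the intersection is dense in two of the spaces,
  proportionality on it extends to them by completeness (\<open>proportional_extend\<close>). If it is not dense in
  \<open>X\<close>, there is a functional \<open>f\<close> that vanishes on \<open>Y\<close> but not on \<open>X\<close>. Now \<open>w \<mapsto> f w z\<close> is an operator of the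
  couple for every \<open>z \<in> X\<close>, and these operators show directly that \<open>X\<close> is proportional to \<open>V\<close> or to \<open>W\<close>
  (\<open>proportional_of_not_dense\<close>). A case distinction by density combines the two arguments
  (\<open>couples_proportional\<close>).
\<close>

section \<open>The Hahn--Banach theorem\<close>

definition linear_functional_on ::
  "('k::real_normed_field \<Rightarrow> 'a::ab_group_add \<Rightarrow> 'a) \<Rightarrow> 'a set \<Rightarrow> ('a \<Rightarrow> 'k) \<Rightarrow> bool" where
  "linear_functional_on s S f \<longleftrightarrow>
     (\<forall>x\<in>S. \<forall>y\<in>S. f (x + y) = f x + f y) \<and> (\<forall>c. \<forall>x\<in>S. f (s c x) = c * f x)"

definition seminorm_on ::
  "('k::real_normed_field \<Rightarrow> 'a::ab_group_add \<Rightarrow> 'a) \<Rightarrow> 'a set \<Rightarrow> ('a \<Rightarrow> real) \<Rightarrow> bool" where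
  "seminorm_on s S q \<longleftrightarrow>
     (\<forall>x\<in>S. \<forall>y\<in>S. q (x + y) \<le> q x + q y) \<and> (\<forall>c. \<forall>x\<in>S. q (s c x) = norm c * q x)"

text \<open>
  The Hahn--Banach theorem is the only point at which the real and the complex case differ. As a
  locale assumption it lets the rest of the argument be carried out once for both scalar fields.
\<close>

locale scalar_space = vector_space s
  for s :: "'k::real_normed_field \<Rightarrow> 'a::ab_group_add \<Rightarrow> 'a"

locale hahn_banach_space = scalar_space s
  for s :: "'k::real_normed_field \<Rightarrow> 'a::ab_group_add \<Rightarrow> 'a" +
  assumes hahn_banach: "\<lbrakk>subspace S; seminorm_on s S q; y \<in> S\<rbrakk> \<Longrightarrow>
    \<exists>f. linear_functional_on s S f \<and> (\<forall>x\<in>S. norm (f x) \<le> q x) \<and> q y \<le> norm (f y)"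

text \<open>
  Over the reals, a minimal sublinear functional is linear. This proof needs no extension of
  partially defined functionals, hence no order on graphs: Zorn's lemma is applied to total
  functions ordered pointwise. They are normalised to vanish off the subspace \<open>S\<close>, since
  otherwise the order would only be a preorder on functions restricted to \<open>S\<close>.
\<close>

context
  fixes s :: "real \<Rightarrow> 'a::ab_group_add \<Rightarrow> 'a" and S :: "'a set"
  assumes vs: "vector_space s" and sub: "module.subspace s S"
begin

interpretation vector_space s by (fact vs)

definition sublinear where
  "sublinear p \<longleftrightarrow> (\<forall>x. x \<notin> S \<longrightarrow> p x = (0::real)) \<and>
     (\<forall>x\<in>S. \<forall>y\<in>S. p (x + y) \<le> p x + p y) \<and> (\<forall>t>0. \<forall>x\<in>S. p (s t x) = t * p x)"

lemma sublinear_zero: "sublinear p \<Longrightarrow> p 0 = 0"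
proof -
  assume p: "sublinear p"
  have "\<forall>t>0. p (s t 0) = t * p 0" using p subspace_0[OF sub] unfolding sublinear_def by blast
  from this[rule_format, of 2] show ?thesis by simp
qed

lemma sublinear_minus_bound: "sublinear p \<Longrightarrow> x \<in> S \<Longrightarrow> - p (- x) \<le> p x"
proof -
  assume p: "sublinear p" and x: "x \<in> S"
  have "p (x + (- x)) \<le> p x + p (- x)"
    using p x subspace_neg[OF sub] unfolding sublinear_def by blast
  then show ?thesis using sublinear_zero[OF p] by simp
qed

text \<open>
  The functional \<open>p' x = inf\<^sub>t (p (x + t y) - t p y)\<close>, with \<open>t\<close> ranging over the nonnegative reals, is
  sublinear, lies below \<open>p\<close> (take \<open>t = 0\<close>), and satisfies \<open>p' (- y) \<le> - p y\<close> (take \<open>t = 1\<close>). It is used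
  twice: applied to a minimal \<open>p\<close> it forces \<open>p (- y) = - p y\<close>, which makes \<open>p\<close> linear, and applied to
  the given seminorm \<open>q\<close> before minimising it secures \<open>q y \<le> g y\<close> for the resulting functional \<open>g\<close>.
\<close>

lemma sublinear_lowering:
  assumes p: "sublinear p" and y: "y \<in> S"
  obtains p' where "sublinear p'" "\<And>x. p' x \<le> p x" "p' (- y) \<le> - p y"
proof -
  define P where "P x t = p (x + s t y) - t * p y" for x t
  define p' where "p' x = (if x \<in> S then INF t\<in>{0..}. P x t else 0)" for x
  have add: "p (x + z) \<le> p x + p z" if "x \<in> S" "z \<in> S" for x z
    using p that unfolding sublinear_def by blast
  have hom: "p (s t x) = t * p x" if "0 < t" "x \<in> S" for t x
    using p that unfolding sublinear_def by blast
  have hom0: "p (s t x) = t * p x" if "0 \<le> t" "x \<in> S" for t x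
    using hom[of t x] that sublinear_zero[OF p] by (cases "t = 0") auto
  have mem: "x + s t y \<in> S" if "x \<in> S" for x t
    using that y subspace_add[OF sub] subspace_scale[OF sub] by blast
  have lower: "- p (- x) \<le> P x t" if "x \<in> S" "0 \<le> t" for x t
  proof -
    have "p ((x + s t y) + (- x)) \<le> p (x + s t y) + p (- x)"
      using add mem that subspace_neg[OF sub] by blast
    then show ?thesis using hom0[OF that(2) y] by (simp add: P_def)
  qed
  have bdd: "bdd_below (P x ` {0..})" if "x \<in> S" for x
    using lower[OF that] by (intro bdd_belowI2) auto
  have le: "p' x \<le> P x t" if "x \<in> S" "0 \<le> t" for x t
    using that bdd[OF that(1)] by (simp add: p'_def cINF_lower)
  have greatest: "c \<le> p' x" if "x \<in> S" "\<And>t. 0 \<le> t \<Longrightarrow> c \<le> P x t" for x c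
    unfolding p'_def using that by (auto intro: cINF_greatest)
  have p'add: "p' (x + z) \<le> p' x + p' z" if x: "x \<in> S" and z: "z \<in> S" for x z
  proof -
    have "p' (x + z) - P x t \<le> p' z" if t: "0 \<le> t" for t
    proof (rule greatest[OF z])
      fix u :: real assume u: "0 \<le> u"
      have "p' (x + z) \<le> P (x + z) (t + u)"
        using le subspace_add[OF sub x z] t u by simp
      also have "\<dots> \<le> P x t + P z u"
        using add[OF mem[OF x, of t] mem[OF z, of u]]
        by (simp add: P_def algebra_simps)
      finally show "p' (x + z) - P x t \<le> P z u" by simp
    qed
    then have "p' (x + z) - p' z \<le> p' x"
      by (intro greatest[OF x]) (simp add: algebra_simps)
    then show ?thesis by simp
  qed
  have hom_le: "p' (s r x) \<le> r * p' x" if r: "0 < r" and x: "x \<in> S" for r x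
  proof -
    have "p' (s r x) / r \<le> p' x"
    proof (rule greatest[OF x])
      fix t :: real assume t: "0 \<le> t"
      have "p' (s r x) \<le> P (s r x) (r * t)"
        using le subspace_scale[OF sub x] r t by simp
      also have "\<dots> = r * P x t"
        using hom[OF r mem[OF x, of t]] by (simp add: P_def algebra_simps)
      finally show "p' (s r x) / r \<le> P x t"
        using r by (simp add: field_simps)
    qed
    then show ?thesis using r by (simp add: field_simps)
  qed
  have p'hom: "p' (s r x) = r * p' x" if r: "0 < r" and x: "x \<in> S" for r x
  proof (rule antisym[OF hom_le[OF r x]])
    have "p' (s (1 / r) (s r x)) \<le> (1 / r) * p' (s r x)"
      by (rule hom_le) (use r subspace_scale[OF sub x] in auto)
    moreover have "s (1 / r) (s r x) = x" using r by simp
    ultimately show "r * p' x \<le> p' (s r x)"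
      using r by (simp add: field_simps)
  qed
  have "sublinear p'"
    unfolding sublinear_def using p'add p'hom by (auto simp: p'_def)
  moreover have "p' x \<le> p x" for x
  proof (cases "x \<in> S")
    case True
    then show ?thesis using le[of x 0] by (simp add: P_def)
  next
    case False
    then show ?thesis using p by (simp add: p'_def sublinear_def)
  qed
  moreover have "p' (- y) \<le> - p y"
    using le[of "- y" 1] subspace_neg[OF sub y] sublinear_zero[OF p] by (simp add: P_def)
  ultimately show thesis using that by blast
qed

text \<open>
  The pointwise infimum of a chain is finite because a sublinear functional satisfies
  \<open>- p (- x) \<le> p x\<close>, so that one member \<open>p0\<close> bounds all smaller ones from below. It is subadditive
  because any two members of the chain have a common lower bound in the chain.
\<close>

lemma sublinear_chain_bound:
  assumes C: "C \<noteq> {}" "\<And>p. p \<in> C \<Longrightarrow> sublinear p"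
    and chain: "\<And>p p'. p \<in> C \<Longrightarrow> p' \<in> C \<Longrightarrow> p \<le> p' \<or> p' \<le> p"
  obtains u where "sublinear u" "\<And>p. p \<in> C \<Longrightarrow> u \<le> p"
proof -
  obtain p0 where p0: "p0 \<in> C" using C by blast
  define u where "u x = (INF p\<in>C. p x)" for x
  have bdd: "bdd_below ((\<lambda>p. p x) ` C)" for x
  proof (cases "x \<in> S")
    case True
    have "min (p0 x) (- p0 (- x)) \<le> p x" if p: "p \<in> C" for p
      using chain[OF p p0]
    proof
      assume "p \<le> p0"
      then have "- p0 (- x) \<le> - p (- x)" by (simp add: le_fun_def)
      also have "\<dots> \<le> p x" by (rule sublinear_minus_bound[OF C(2)[OF p] True])
      finally show ?thesis by simp
    next
      assume "p0 \<le> p"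
      then show ?thesis by (simp add: le_fun_def min.coboundedI1)
    qed
    then show ?thesis by (intro bdd_belowI2)
  next
    case False
    then have "p x = 0" if "p \<in> C" for p using C(2)[OF that] by (simp add: sublinear_def)
    then have "0 \<le> p x" if "p \<in> C" for p using that by force
    then show ?thesis by (rule bdd_belowI2)
  qed
  have le: "u x \<le> p x" if "p \<in> C" for x p
    unfolding u_def using that bdd by (intro cINF_lower)
  have greatest: "c \<le> u x" if "\<And>p. p \<in> C \<Longrightarrow> c \<le> p x" for c x
    unfolding u_def using that C(1) by (intro cINF_greatest)
  have "u (x + y) \<le> u x + u y" if xy: "x \<in> S" "y \<in> S" for x y
  proof -
    have "u (x + y) - p x \<le> u y" if p: "p \<in> C" for p
    proof (rule greatest)
      fix p' assume p': "p' \<in> C"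
      obtain r where r: "r \<in> C" "r \<le> p" "r \<le> p'" using chain[OF p p'] p p' by blast
      have "u (x + y) \<le> r (x + y)" by (rule le[OF r(1)])
      also have "\<dots> \<le> r x + r y" using C(2)[OF r(1)] xy by (simp add: sublinear_def)
      also have "\<dots> \<le> p x + p' y" using r by (simp add: le_fun_def add_mono)
      finally show "u (x + y) - p x \<le> p' y" by simp
    qed
    then have "u (x + y) - u y \<le> u x" by (intro greatest) (simp add: algebra_simps)
    then show ?thesis by simp
  qed
  moreover have "u (s t x) = t * u x" if t: "0 < t" and x: "x \<in> S" for t x
  proof (rule antisym)
    have "u (s t x) / t \<le> u x"
    proof (rule greatest)
      fix p assume p: "p \<in> C"
      have "p (s t x) = t * p x" using C(2)[OF p] t x by (simp add: sublinear_def)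
      with le[OF p, of "s t x"] show "u (s t x) / t \<le> p x" using t by (simp add: field_simps)
    qed
    then show "u (s t x) \<le> t * u x" using t by (simp add: field_simps)
    show "t * u x \<le> u (s t x)"
    proof (rule greatest)
      fix p assume p: "p \<in> C"
      have "p (s t x) = t * p x" using C(2)[OF p] t x by (simp add: sublinear_def)
      with le[OF p, of x] show "t * u x \<le> p (s t x)" using t by simp
    qed
  qed
  moreover have "u x = 0" if "x \<notin> S" for x
    using le[OF p0, of x] greatest[of 0 x] C(2) p0 that by (force simp: sublinear_def)
  ultimately have "sublinear u" unfolding sublinear_def by blast
  then show thesis using that le by (simp add: le_fun_def)
qed

lemma minimal_sublinear:
  assumes q: "sublinear q"
  obtains p where "sublinear p" "p \<le> q" "\<And>p'. sublinear p' \<Longrightarrow> p' \<le> p \<Longrightarrow> p' = p"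
proof -
  define A where "A = {p. sublinear p \<and> p \<le> q}"
  have "\<exists>m\<in>A. \<forall>a\<in>A. m \<ge> a \<longrightarrow> a = m"
  proof (rule predicate_Zorn)
    show "partial_order_on A (relation_of (\<ge>) A)"
      by (rule partial_order_on_relation_ofI) auto
    fix C assume C: "C \<in> Chains (relation_of (\<ge>) A)"
    then have CA: "p \<in> A" if "p \<in> C" for p
      using that by (auto simp: Chains_def relation_of_def)
    show "\<exists>u\<in>A. \<forall>a\<in>C. a \<ge> u"
    proof (cases "C = {}")
      case True
      then show ?thesis using q by (auto simp: A_def)
    next
      case False
      have "sublinear p" if "p \<in> C" for p using CA[OF that] by (simp add: A_def)
      moreover have "p \<le> p' \<or> p' \<le> p" if "p \<in> C" "p' \<in> C" for p p'
        using C that by (auto simp: Chains_def relation_of_def)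
      ultimately obtain u where u: "sublinear u" "\<And>p. p \<in> C \<Longrightarrow> u \<le> p"
        using sublinear_chain_bound[OF False] by blast
      obtain p where "p \<in> C" using False by blast
      then have "u \<le> q" using u(2)[of p] CA[of p] by (auto simp: A_def)
      then show ?thesis using u by (auto simp: A_def)
    qed
  qed
  then obtain m where m: "m \<in> A" "\<And>a. a \<in> A \<Longrightarrow> a \<le> m \<Longrightarrow> a = m" by blast
  show thesis
  proof (rule that)
    show "sublinear m" "m \<le> q" using m(1) by (auto simp: A_def)
    show "p' = m" if "sublinear p'" "p' \<le> m" for p'
      using m that by (auto simp: A_def)
  qed
qed

lemma real_hahn_banach:
  assumes q: "seminorm_on s S q" and y: "y \<in> S"
  obtains g where "linear_functional_on s S g" "\<And>x. x \<in> S \<Longrightarrow> g x \<le> q x" "q y \<le> g y"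
proof -
  define q0 where "q0 x = (if x \<in> S then q x else 0)" for x
  have "sublinear q0"
    using q subspace_add[OF sub] subspace_scale[OF sub]
    by (auto simp: sublinear_def seminorm_on_def q0_def)
  then obtain q' where q': "sublinear q'" "\<And>x. q' x \<le> q0 x" "q' (- y) \<le> - q0 y"
    using sublinear_lowering y by blast
  obtain p where p: "sublinear p" "p \<le> q'" "\<And>p'. sublinear p' \<Longrightarrow> p' \<le> p \<Longrightarrow> p' = p"
    using minimal_sublinear[OF q'(1)] by blast
  have add_le: "p (x + z) \<le> p x + p z" if "x \<in> S" "z \<in> S" for x z
    using p(1) that by (simp add: sublinear_def)
  have neg: "p (- x) = - p x" if x: "x \<in> S" for x
  proof -
    obtain p' where p': "sublinear p'" "\<And>z. p' z \<le> p z" "p' (- x) \<le> - p x"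
      using sublinear_lowering[OF p(1) x] by blast
    then have "p' = p" using p(3) by (simp add: le_fun_def)
    then show ?thesis using p'(3) sublinear_minus_bound[OF p(1) x] by simp
  qed
  have add: "p (x + z) = p x + p z" if x: "x \<in> S" and z: "z \<in> S" for x z
  proof -
    have "p ((x + z) + (- z)) \<le> p (x + z) + p (- z)"
      using add_le subspace_add[OF sub x z] subspace_neg[OF sub z] by blast
    then show ?thesis using add_le[OF x z] neg[OF z] by simp
  qed
  have "p (s c x) = c * p x" if x: "x \<in> S" for c x
  proof (cases c "0::real" rule: linorder_cases)
    case less
    have "p (s (- c) x) = (- c) * p x" using p(1) less x unfolding sublinear_def by (meson neg_0_less_iff_less)
    then show ?thesis using neg[OF subspace_scale[OF sub x, of c]] by (simp add: scale_minus_left)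
  next
    case equal
    then show ?thesis using sublinear_zero[OF p(1)] by simp
  next
    case greater
    then show ?thesis using p(1) x by (simp add: sublinear_def)
  qed
  then have "linear_functional_on s S p"
    using add by (simp add: linear_functional_on_def)
  moreover have "p x \<le> q x" if "x \<in> S" for x
    using p(2) q'(2)[of x] that by (auto simp: le_fun_def q0_def intro: order_trans)
  moreover have "q y \<le> p y"
  proof -
    have "p (- y) \<le> q' (- y)" using p(2) by (simp add: le_fun_def)
    then show ?thesis using q'(3) neg[OF y] y by (simp add: q0_def)
  qed
  ultimately show thesis using that by blast
qed

end

lemma real_hahn_banach_space:
  fixes s :: "real \<Rightarrow> 'a::ab_group_add \<Rightarrow> 'a"
  assumes "vector_space s"
  shows "hahn_banach_space s"
proof -
  interpret vector_space s by (fact assms)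
  show ?thesis
  proof unfold_locales
    fix S q y assume S: "subspace S" and q: "seminorm_on s S q" and y: "y \<in> S"
    obtain g where g: "linear_functional_on s S g" "\<And>x. x \<in> S \<Longrightarrow> g x \<le> q x" "q y \<le> g y"
      using real_hahn_banach[OF assms S q y] by blast
    have "norm (g x) \<le> q x" if x: "x \<in> S" for x
    proof -
      have "g (s (-1) x) \<le> q (s (-1) x)" using g(2) subspace_scale[OF S x] by blast
      moreover have "g (s (-1) x) = (-1) * g x"
        using g(1) x unfolding linear_functional_on_def by blast
      moreover have "q (s (-1) x) = norm (-1::real) * q x"
        using q x unfolding seminorm_on_def by blast
      ultimately show ?thesis using g(2)[OF x] by (simp add: abs_le_iff)
    qed
    then show "\<exists>f. linear_functional_on s S f \<and> (\<forall>x\<in>S. norm (f x) \<le> q x) \<and> q y \<le> norm (f y)"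
      using g(1,3) by (intro exI[of _ g]) auto
  qed
qed

text \<open>
  The usual complexification \<open>f x = g x - \<i> g (\<i> x)\<close> of a real linear functional \<open>g \<le> q\<close>. A
  rotation by a scalar of modulus one makes \<open>f x\<close> real, and then its modulus is a value of \<open>g\<close>.
\<close>

lemma complex_hahn_banach_space:
  fixes s :: "complex \<Rightarrow> 'a::ab_group_add \<Rightarrow> 'a"
  assumes "vector_space s"
  shows "hahn_banach_space s"
proof -
  interpret vector_space s by (fact assms)
  define r where "r c = s (complex_of_real c)" for c
  have vr: "vector_space r"
    by unfold_locales (simp_all add: r_def algebra_simps)
  show ?thesis
  proof unfold_locales
    fix S q y assume S: "subspace S" and q: "seminorm_on s S q" and y: "y \<in> S"
    have Sr: "module.subspace r S"
      using S vr unfolding module_iff_vector_space[symmetric]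
      by (simp add: module.subspace_def subspace_def r_def)
    have qr: "seminorm_on r S q"
      using q by (simp add: seminorm_on_def r_def)
    obtain g where g: "linear_functional_on r S g" "\<And>x. x \<in> S \<Longrightarrow> g x \<le> q x" "q y \<le> g y"
      using real_hahn_banach[OF vr Sr qr y] by blast
    have gadd: "g (x + z) = g x + g z" if "x \<in> S" "z \<in> S" for x z
      using g(1) that by (simp add: linear_functional_on_def)
    have gre: "g (s (complex_of_real c) x) = c * g x" if "x \<in> S" for x c
      using g(1) that by (simp add: linear_functional_on_def r_def)
    define f where "f x = Complex (g x) (- g (s \<i> x))" for x
    have fadd: "f (x + z) = f x + f z" if "x \<in> S" "z \<in> S" for x z
      using that gadd subspace_scale[OF S] by (simp add: f_def scale_right_distrib complex_eq_iff)
    have fscale: "f (s c x) = c * f x" if x: "x \<in> S" for c x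
    proof -
      have *: "g (s (Complex a b) x) = a * g x + b * g (s \<i> x)" for a b
      proof -
        have "s (Complex a b) x = s (complex_of_real a) x + s (complex_of_real b) (s \<i> x)"
          by (simp add: Complex_eq scale_left_distrib mult.commute)
        then have "g (s (Complex a b) x) =
            g (s (complex_of_real a) x) + g (s (complex_of_real b) (s \<i> x))"
          using gadd x subspace_scale[OF S] by (simp del: scale_scale)
        then show ?thesis using gre x subspace_scale[OF S] by (simp del: scale_scale)
      qed
      have "\<i> * c = Complex (- Im c) (Re c)" by (simp add: complex_eq_iff)
      then have "g (s \<i> (s c x)) = - Im c * g x + Re c * g (s \<i> x)"
        using *[of "- Im c" "Re c"] by simp
      then show ?thesis
        using *[of "Re c" "Im c"] by (simp add: f_def complex_eq_iff)
    qed
    have "norm (f x) \<le> q x" if x: "x \<in> S" for x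
    proof (cases "f x = 0")
      case True
      have "q 0 = 0"
        using q[unfolded seminorm_on_def] subspace_0[OF S] by (metis mult_zero_left norm_zero scale_zero_left)
      moreover have "q (x + s (-1) x) \<le> q x + q (s (-1) x)"
        using q x subspace_scale[OF S] unfolding seminorm_on_def by blast
      moreover have "q (s (-1) x) = norm (-1::complex) * q x"
        using q x unfolding seminorm_on_def by blast
      ultimately show ?thesis using True by simp
    next
      case False
      define c where "c = cnj (f x) / norm (f x)"
      have c: "c * f x = norm (f x)" "norm c = 1"
        using False by (simp_all add: c_def norm_divide mult.commute complex_norm_square[symmetric] power2_eq_square)
      have "norm (f x) = Re (f (s c x))" using fscale[OF x, of c] c(1) by simp
      also have "\<dots> = g (s c x)" by (simp add: f_def)
      also have "\<dots> \<le> q (s c x)" using g(2) subspace_scale[OF S x] by blast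
      also have "\<dots> = q x" using q x c(2) by (simp add: seminorm_on_def)
      finally show ?thesis .
    qed
    moreover have "q y \<le> norm (f y)"
      using g(3) complex_Re_le_cmod[of "f y"] by (simp add: f_def)
    ultimately show "\<exists>f. linear_functional_on s S f \<and> (\<forall>x\<in>S. norm (f x) \<le> q x) \<and> q y \<le> norm (f y)"
      using fadd fscale by (intro exI[of _ f]) (auto simp: linear_functional_on_def)
  qed
qed

section \<open>Normed spaces and Banach couples\<close>

definition norm_lim :: "'a::ab_group_add nspace \<Rightarrow> (nat \<Rightarrow> 'a) \<Rightarrow> 'a \<Rightarrow> bool" where
  "norm_lim E u x \<longleftrightarrow>
     x \<in> space_of E \<and> range u \<subseteq> space_of E \<and> (\<lambda>n. norm_of E (u n - x)) \<longlonglongrightarrow> 0"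

text \<open>
  For \<open>a = b = 1\<close> this is the norm of \<open>X + Y\<close>, and for positive weights it is Peetre's K-functional up
  to normalisation. For \<open>a = 1\<close> and \<open>b = 0\<close> it is the quotient seminorm of \<open>X + Y\<close> modulo \<open>Y\<close>.
\<close>

definition decomposition_norm ::
  "real \<Rightarrow> real \<Rightarrow> 'a::ab_group_add nspace \<Rightarrow> 'a nspace \<Rightarrow> 'a \<Rightarrow> real" where
  "decomposition_norm a b X Y w =
     Inf {a * norm_of X x + b * norm_of Y y |x y. x \<in> space_of X \<and> y \<in> space_of Y \<and> w = x + y}"

context scalar_space
begin

context
  fixes E :: "'a nspace"
  assumes E: "normed_space s E"
begin

lemma normed_subspace: "subspace (space_of E)"
  using E by (simp add: normed_space_def)

lemma normed_zero_mem: "0 \<in> space_of E"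
  by (rule subspace_0[OF normed_subspace])

lemma normed_add_mem: "x \<in> space_of E \<Longrightarrow> y \<in> space_of E \<Longrightarrow> x + y \<in> space_of E"
  by (rule subspace_add[OF normed_subspace])

lemma normed_diff_mem: "x \<in> space_of E \<Longrightarrow> y \<in> space_of E \<Longrightarrow> x - y \<in> space_of E"
  by (rule subspace_diff[OF normed_subspace])

lemma normed_scale_mem: "x \<in> space_of E \<Longrightarrow> s c x \<in> space_of E"
  by (rule subspace_scale[OF normed_subspace])

lemma normed_nonneg: "0 \<le> norm_of E x"
  using E by (cases "x \<in> space_of E") (auto simp: normed_space_def)

lemma normed_eq_0: "x \<in> space_of E \<Longrightarrow> norm_of E x = 0 \<longleftrightarrow> x = 0"
  using E by (simp add: normed_space_def)

lemma normed_pos: "x \<in> space_of E \<Longrightarrow> x \<noteq> 0 \<Longrightarrow> 0 < norm_of E x"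
  using normed_nonneg[of x] normed_eq_0[of x] by linarith

lemma normed_norm_0: "norm_of E 0 = 0"
  using normed_eq_0 normed_zero_mem by blast

lemma normed_triangle:
  "x \<in> space_of E \<Longrightarrow> y \<in> space_of E \<Longrightarrow> norm_of E (x + y) \<le> norm_of E x + norm_of E y"
  using E by (simp add: normed_space_def)

lemma normed_scale: "x \<in> space_of E \<Longrightarrow> norm_of E (s c x) = norm c * norm_of E x"
  using E by (simp add: normed_space_def)

lemma normed_minus: "norm_of E (- x) = norm_of E x"
proof (cases "x \<in> space_of E")
  case True
  then show ?thesis using normed_scale[OF True, of "- 1"] by simp
next
  case False
  then have "- x \<notin> space_of E" using subspace_neg[OF normed_subspace, of "- x"] by auto
  with False show ?thesis using E by (simp add: normed_space_def)
qed

lemma normed_diff_commute: "norm_of E (x - y) = norm_of E (y - x)"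
  using normed_minus[of "x - y"] by simp

lemma normed_diff_triangle:
  assumes "x \<in> space_of E" "y \<in> space_of E" "z \<in> space_of E"
  shows "norm_of E (x - z) \<le> norm_of E (x - y) + norm_of E (y - z)"
  using normed_triangle[of "x - y" "y - z"] normed_diff_mem assms by simp

lemma normed_metric: "Metric_space (space_of E) (\<lambda>x y. norm_of E (x - y))"
  using normed_nonneg normed_diff_commute normed_diff_triangle normed_eq_0 normed_diff_mem
  by unfold_locales auto

lemma limitin_norm_top_iff:
  "range u \<subseteq> space_of E \<Longrightarrow> limitin (norm_top E) u x sequentially \<longleftrightarrow> norm_lim E u x"
  by (auto simp: norm_lim_def norm_top_def image_subset_iff
      Metric_space.limitin_metric_dist_null[OF normed_metric])

lemma norm_lim_unique: "norm_lim E u x \<Longrightarrow> norm_lim E u y \<Longrightarrow> x = y"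
  by (metis Metric_space.limitin_metric_unique limitin_norm_top_iff norm_lim_def norm_top_def
      normed_metric sequentially_bot)

lemma norm_lim_norm:
  assumes "norm_lim E u x"
  shows "(\<lambda>n. norm_of E (u n)) \<longlonglongrightarrow> norm_of E x"
proof (rule LIM_zero_cancel, rule Lim_null_comparison)
  show "(\<lambda>n. norm_of E (u n - x)) \<longlonglongrightarrow> 0" using assms by (simp add: norm_lim_def)
  have "\<bar>norm_of E (u n) - norm_of E x\<bar> \<le> norm_of E (u n - x)" for n
    using assms normed_diff_triangle[of "u n" x 0] normed_diff_triangle[of x "u n" 0]
      normed_diff_commute[of x "u n"] normed_zero_mem
    by (auto simp: norm_lim_def image_subset_iff)
  then show "\<forall>\<^sub>F n in sequentially. norm (norm_of E (u n) - norm_of E x) \<le> norm_of E (u n - x)"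
    by simp
qed

end

lemma banach_normed: "banach_space s E \<Longrightarrow> normed_space s E"
  by (simp add: banach_space_def)

lemma banach_complete:
  assumes E: "banach_space s E" and u: "range u \<subseteq> space_of E"
    and cauchy: "\<And>e. 0 < e \<Longrightarrow> \<exists>N. \<forall>m\<ge>N. \<forall>n\<ge>N. norm_of E (u m - u n) < e"
  obtains x where "norm_lim E u x"
proof -
  note n = banach_normed[OF E]
  note met = normed_metric[OF n]
  have "Metric_space.MCauchy (space_of E) (\<lambda>x y. norm_of E (x - y)) u"
    unfolding Metric_space.MCauchy_def[OF met] using u cauchy by metis
  then obtain x where "limitin (norm_top E) u x sequentially"
    using E unfolding banach_space_def Metric_space.mcomplete_def[OF met] norm_top_def by blast
  then show thesis using that limitin_norm_top_iff[OF n u] by blast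
qed

lemma cont_embedded_norm_lim:
  assumes "normed_space s E" "normed_space s F" "E \<hookrightarrow> F" "norm_lim E u x"
  shows "norm_lim F u x"
proof -
  have u: "range u \<subseteq> space_of E" "range u \<subseteq> space_of F"
    using assms(3,4) by (auto simp: norm_lim_def cont_embedded_def)
  have "limitin (norm_top F) (id \<circ> u) (id x) sequentially"
    using assms u by (intro continuous_map_limit[of "norm_top E"])
      (auto simp: limitin_norm_top_iff cont_embedded_def)
  then show ?thesis using assms u by (simp add: limitin_norm_top_iff)
qed

text \<open>
  This applies to the inclusions of \<open>X \<inter> Y\<close> in \<open>X\<close> and of \<open>X\<close> in \<open>X + Y\<close>, which do not increase norms.
\<close>

lemma cont_embeddedI:
  assumes E: "normed_space s E" and F: "normed_space s F"
    and sub: "space_of E \<subseteq> space_of F" and le: "\<And>x. x \<in> space_of E \<Longrightarrow> norm_of F x \<le> norm_of E x"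
  shows "E \<hookrightarrow> F"
proof -
  have "continuous_map (norm_top E) (norm_top F) id"
    unfolding norm_top_def Metric_space.metric_continuous_map[OF normed_metric[OF E] normed_metric[OF F]]
  proof (intro conjI strip)
    fix a and e :: real assume "a \<in> space_of E" "0 < e"
    then show "\<exists>\<delta>>0. \<forall>x. x \<in> space_of E \<and> norm_of E (a - x) < \<delta> \<longrightarrow> norm_of F (id a - id x) < e"
      using le normed_diff_mem[OF E] by (intro exI[of _ e]) (auto intro: le_less_trans)
  qed (use sub in auto)
  then show ?thesis using sub by (simp add: cont_embedded_def)
qed

lemma couple_inter_normed:
  assumes "normed_space s X" "normed_space s Y"
  shows "normed_space s (couple_inter X Y)"
  unfolding normed_space_def
proof (intro conjI)
  show "subspace (space_of (couple_inter X Y))"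
    using assms by (simp add: couple_inter_def normed_subspace subspace_inter)
  show "\<forall>x\<in>space_of (couple_inter X Y). \<forall>y\<in>space_of (couple_inter X Y).
      norm_of (couple_inter X Y) (x + y) \<le> norm_of (couple_inter X Y) x + norm_of (couple_inter X Y) y"
    using assms normed_triangle[OF assms(1)] normed_triangle[OF assms(2)]
    by (auto simp: couple_inter_def normed_add_mem) (smt (verit))+
  show "\<forall>c. \<forall>x\<in>space_of (couple_inter X Y).
      norm_of (couple_inter X Y) (s c x) = norm c * norm_of (couple_inter X Y) x"
    using assms by (auto simp: couple_inter_def normed_scale normed_scale_mem max_mult_distrib_left)
qed (use assms in \<open>auto simp: couple_inter_def normed_nonneg normed_eq_0 max_def\<close>)

lemma mem_couple_sum:
  "w \<in> space_of (couple_sum X Y) \<longleftrightarrow> (\<exists>x\<in>space_of X. \<exists>y\<in>space_of Y. w = x + y)"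
  by (auto simp: couple_sum_def)

lemma norm_couple_sum:
  "w \<in> space_of (couple_sum X Y) \<Longrightarrow> norm_of (couple_sum X Y) w = decomposition_norm 1 1 X Y w"
  by (simp add: couple_sum_def decomposition_norm_def)

lemma couple_sum_commute_space: "space_of (couple_sum X Y) = space_of (couple_sum Y X)"
  by (auto simp: mem_couple_sum) (metis add.commute)+

context
  fixes X Y :: "'a nspace"
  assumes X: "normed_space s X" and Y: "normed_space s Y"
begin

lemma subspace_couple_sum: "subspace (space_of (couple_sum X Y))"
  using subspace_sums[OF normed_subspace[OF X] normed_subspace[OF Y]] by (simp add: couple_sum_def)

lemma couple_sum_left: "x \<in> space_of X \<Longrightarrow> x \<in> space_of (couple_sum X Y)"
  using normed_zero_mem[OF Y] by (force simp: mem_couple_sum)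

lemma couple_sum_right: "y \<in> space_of Y \<Longrightarrow> y \<in> space_of (couple_sum X Y)"
  using normed_zero_mem[OF X] by (force simp: mem_couple_sum)

context
  fixes a b :: real
  assumes a: "0 \<le> a" and b: "0 \<le> b"
begin

lemma decomposition_norm_le:
  assumes "x \<in> space_of X" "y \<in> space_of Y"
  shows "decomposition_norm a b X Y (x + y) \<le> a * norm_of X x + b * norm_of Y y"
  unfolding decomposition_norm_def
proof (rule cInf_lower)
  show "bdd_below {a * norm_of X x' + b * norm_of Y y' |x' y'.
      x' \<in> space_of X \<and> y' \<in> space_of Y \<and> x + y = x' + y'}"
    using a b normed_nonneg[OF X] normed_nonneg[OF Y] by (intro bdd_belowI[of _ 0]) auto
qed (use assms in blast)

lemma decomposition_norm_greatest:
  assumes "w \<in> space_of (couple_sum X Y)"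
    and "\<And>x y. x \<in> space_of X \<Longrightarrow> y \<in> space_of Y \<Longrightarrow> w = x + y \<Longrightarrow>
      c \<le> a * norm_of X x + b * norm_of Y y"
  shows "c \<le> decomposition_norm a b X Y w"
  unfolding decomposition_norm_def
proof (rule cInf_greatest)
  show "{a * norm_of X x + b * norm_of Y y |x y.
      x \<in> space_of X \<and> y \<in> space_of Y \<and> w = x + y} \<noteq> {}"
    using assms(1) by (auto simp: mem_couple_sum)
qed (use assms(2) in blast)

lemma decomposition_norm_nonneg:
  "w \<in> space_of (couple_sum X Y) \<Longrightarrow> 0 \<le> decomposition_norm a b X Y w"
  by (rule decomposition_norm_greatest) (use a b normed_nonneg[OF X] normed_nonneg[OF Y] in auto)

lemma decomposition_norm_scale_le:
  assumes w: "w \<in> space_of (couple_sum X Y)"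
  shows "decomposition_norm a b X Y (s c w) \<le> norm c * decomposition_norm a b X Y w"
proof -
  have *: "decomposition_norm a b X Y (s c w) \<le> norm c * (a * norm_of X x + b * norm_of Y y)"
    if "x \<in> space_of X" "y \<in> space_of Y" "w = x + y" for x y
    using decomposition_norm_le[of "s c x" "s c y"] that normed_scale[OF X] normed_scale[OF Y]
      normed_scale_mem[OF X] normed_scale_mem[OF Y]
    by (simp add: scale_right_distrib algebra_simps)
  show ?thesis
  proof (cases "c = 0")
    case True
    then show ?thesis using * w by (auto simp: mem_couple_sum)
  next
    case False
    have "decomposition_norm a b X Y (s c w) / norm c \<le> decomposition_norm a b X Y w"
      by (rule decomposition_norm_greatest[OF w])
        (use False * in \<open>simp add: field_simps\<close>)
    then show ?thesis using False by (simp add: field_simps)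
  qed
qed

lemma seminorm_decomposition:
  "seminorm_on s (space_of (couple_sum X Y)) (decomposition_norm a b X Y)"
  unfolding seminorm_on_def
proof (intro conjI strip)
  let ?q = "decomposition_norm a b X Y"
  fix w assume w: "w \<in> space_of (couple_sum X Y)"
  show "?q (w + w') \<le> ?q w + ?q w'" if w': "w' \<in> space_of (couple_sum X Y)" for w'
  proof -
    have "?q (w + w') - ?q w' \<le> ?q w"
    proof (rule decomposition_norm_greatest[OF w])
      fix x y assume xy: "x \<in> space_of X" "y \<in> space_of Y" "w = x + y"
      have "?q (w + w') - (a * norm_of X x + b * norm_of Y y) \<le> ?q w'"
      proof (rule decomposition_norm_greatest[OF w'])
        fix x' y' assume xy': "x' \<in> space_of X" "y' \<in> space_of Y" "w' = x' + y'"
        have "?q ((x + x') + (y + y')) \<le> a * norm_of X (x + x') + b * norm_of Y (y + y')"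
          using xy xy' by (intro decomposition_norm_le normed_add_mem X Y)
        also have "\<dots> \<le> a * (norm_of X x + norm_of X x') + b * (norm_of Y y + norm_of Y y')"
          using xy xy' a b by (intro add_mono mult_left_mono normed_triangle X Y)
        finally show "?q (w + w') - (a * norm_of X x + b * norm_of Y y)
            \<le> a * norm_of X x' + b * norm_of Y y'"
          using xy(3) xy'(3) by (simp add: algebra_simps)
      qed
      then show "?q (w + w') - ?q w' \<le> a * norm_of X x + b * norm_of Y y" by simp
    qed
    then show ?thesis by simp
  qed
  show "?q (s c w) = norm c * ?q w" for c
  proof (rule antisym[OF decomposition_norm_scale_le[OF w]])
    show "norm c * ?q w \<le> ?q (s c w)"
    proof (cases "c = 0")
      case True
      then show ?thesis
        using decomposition_norm_nonneg[OF subspace_scale[OF subspace_couple_sum w, of 0]] by simp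
    next
      case False
      have "?q (s (1 / c) (s c w)) \<le> norm (1 / c) * ?q (s c w)"
        by (rule decomposition_norm_scale_le[OF subspace_scale[OF subspace_couple_sum w]])
      moreover have "s (1 / c) (s c w) = w" using False by simp
      ultimately show ?thesis using False by (simp add: norm_divide field_simps)
    qed
  qed
qed

end

end

text \<open>
  Definiteness of the norm of \<open>X + Y\<close> is where the ambient Hausdorff space enters: if \<open>z\<close> has
  decompositions \<open>z = x\<^sub>n + y\<^sub>n\<close> with both parts tending to zero, then the constant sequence \<open>z\<close>
  tends to \<open>0\<close> there.
\<close>

lemma couple_sum_normed:
  assumes c: "banach_couple s X Y"
  shows "normed_space s (couple_sum X Y)"
proof -
  have X: "normed_space s X" and Y: "normed_space s Y"
    using c by (simp_all add: banach_couple_def banach_space_def)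
  obtain A where A: "hausdorff_tvs s A" "continuous_map (norm_top X) A id"
    "continuous_map (norm_top Y) A id" "space_of X \<subseteq> topspace A" "space_of Y \<subseteq> topspace A"
    using c by (auto simp: banach_couple_def)
  let ?q = "decomposition_norm 1 1 X Y" and ?S = "space_of (couple_sum X Y)"
  note semi = seminorm_decomposition[OF X Y zero_le_one zero_le_one]
  have definite: "w = 0" if w: "w \<in> ?S" and q: "?q w = 0" for w
  proof -
    have "\<exists>x y. x \<in> space_of X \<and> y \<in> space_of Y \<and> w = x + y \<and>
        norm_of X x + norm_of Y y < 1 / (real n + 1)" for n
    proof (rule ccontr)
      assume "\<not> ?thesis"
      then have "1 / (real n + 1) \<le> ?q w"
        by (intro decomposition_norm_greatest[OF X Y _ _ w]) force+
      with q show False by (simp add: field_simps)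
    qed
    then obtain x y where xy: "\<And>n. x n \<in> space_of X" "\<And>n. y n \<in> space_of Y" "\<And>n. w = x n + y n"
      "\<And>n. norm_of X (x n) + norm_of Y (y n) < 1 / (real n + 1)"
      by metis
    have inv: "(\<lambda>n. 1 / (real n + 1)) \<longlonglongrightarrow> 0"
      using LIMSEQ_inverse_real_of_nat by (simp add: inverse_eq_divide add.commute)
    have "(\<lambda>n. norm_of X (x n)) \<longlonglongrightarrow> 0" "(\<lambda>n. norm_of Y (y n)) \<longlonglongrightarrow> 0"
      using xy(4) normed_nonneg[OF X] normed_nonneg[OF Y]
      by (intro tendsto_sandwich[OF _ _ tendsto_const inv] always_eventually allI; smt (verit))+
    then have "norm_lim X x 0" "norm_lim Y y 0"
      using xy normed_zero_mem X Y by (auto simp: norm_lim_def)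
    then have "limitin (norm_top X) x 0 sequentially" "limitin (norm_top Y) y 0 sequentially"
      using limitin_norm_top_iff X Y by (auto simp: norm_lim_def)
    then have "limitin A (id \<circ> x) (id 0) sequentially" "limitin A (id \<circ> y) (id 0) sequentially"
      using A(2,3) by (blast intro: continuous_map_limit)+
    then have "limitin (prod_topology A A) (\<lambda>n. (x n, y n)) (0, 0) sequentially"
      by (simp add: limitin_pairwise comp_def)
    then have "limitin A ((\<lambda>(x, y). x + y) \<circ> (\<lambda>n. (x n, y n))) ((\<lambda>(x, y). x + y) (0, 0)) sequentially"
      using A(1) by (intro continuous_map_limit) (auto simp: hausdorff_tvs_def)
    then have lim0: "limitin A (\<lambda>n. w) 0 sequentially"
      using xy(3) by (simp add: comp_def flip: xy(3))
    have "w \<in> topspace A"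
      using w A(1,4,5) by (auto simp: hausdorff_tvs_def mem_couple_sum intro!: subspace_add)
    then have "limitin A (\<lambda>n. w) w sequentially" by simp
    from limitin_Hausdorff_unique[OF this lim0] show "w = 0"
      using A(1) by (simp add: hausdorff_tvs_def)
  qed
  have q0: "?q 0 = 0"
    using decomposition_norm_le[OF X Y zero_le_one zero_le_one normed_zero_mem[OF X] normed_zero_mem[OF Y]]
      decomposition_norm_nonneg[OF X Y zero_le_one zero_le_one couple_sum_left[OF X Y normed_zero_mem[OF X]]]
      normed_norm_0[OF X] normed_norm_0[OF Y] by simp
  show ?thesis
    unfolding normed_space_def
  proof (intro conjI)
    show "\<forall>w. w \<notin> ?S \<longrightarrow> norm_of (couple_sum X Y) w = 0" by (auto simp: couple_sum_def)
    show "\<forall>w\<in>?S. (norm_of (couple_sum X Y) w = 0) = (w = 0)"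
      using definite q0 by (auto simp: norm_couple_sum)
  qed (use semi subspace_couple_sum[OF X Y] in \<open>auto simp: norm_couple_sum seminorm_on_def
      subspace_add subspace_scale decomposition_norm_nonneg[OF X Y zero_le_one zero_le_one]\<close>)
qed

end

section \<open>Couples with the same operators\<close>

definition bounded_functional :: "'a nspace \<Rightarrow> ('a \<Rightarrow> 'k::real_normed_field) \<Rightarrow> bool" where
  "bounded_functional E f \<longleftrightarrow> (\<exists>C. \<forall>x\<in>space_of E. norm (f x) \<le> C * norm_of E x)"

definition dual_norm :: "'a nspace \<Rightarrow> ('a \<Rightarrow> 'k::real_normed_field) \<Rightarrow> real" where
  "dual_norm E f = Sup {norm (f x) |x. x \<in> space_of E \<and> norm_of E x \<le> 1}"

text \<open>
  For \<open>z \<noteq> 0\<close> this characterises when the rank one operator \<open>x \<mapsto> f x z\<close> maps \<open>E\<close> boundedly into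
  itself. The second alternative matters: a functional that vanishes on \<open>Y\<close> gives operators of the
  couple \<open>(X, Y)\<close> for every \<open>z \<in> X\<close>, also outside the intersection.
\<close>

definition admissible :: "'a nspace \<Rightarrow> ('a \<Rightarrow> 'k::real_normed_field) \<Rightarrow> 'a \<Rightarrow> bool" where
  "admissible E f z \<longleftrightarrow> bounded_functional E f \<and> (z \<in> space_of E \<or> (\<forall>x\<in>space_of E. f x = 0))"

lemma linear_functional_on_subset:
  "linear_functional_on s S f \<Longrightarrow> S' \<subseteq> S \<Longrightarrow> linear_functional_on s S' f"
  by (simp add: linear_functional_on_def subset_iff)

context scalar_space
begin

lemma linear_functional_zero:
  assumes "linear_functional_on s S f" "0 \<in> S"
  shows "f 0 = 0"
proof -
  have "f (s 0 0) = 0 * f 0" using assms unfolding linear_functional_on_def by blast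
  then show ?thesis by simp
qed

context
  fixes E :: "'a nspace" and f :: "'a \<Rightarrow> 'k"
  assumes E: "normed_space s E" and f: "linear_functional_on s (space_of E) f"
begin

lemma dual_norm_least:
  assumes "0 \<le> C" "\<And>x. x \<in> space_of E \<Longrightarrow> norm (f x) \<le> C * norm_of E x"
  shows "dual_norm E f \<le> C"
  unfolding dual_norm_def
proof (rule cSup_least)
  show "{norm (f x) |x. x \<in> space_of E \<and> norm_of E x \<le> 1} \<noteq> {}"
    using normed_zero_mem[OF E] normed_norm_0[OF E] by force
  show "r \<le> C" if r: "r \<in> {norm (f x) |x. x \<in> space_of E \<and> norm_of E x \<le> 1}" for r
  proof -
    obtain x where x: "r = norm (f x)" "x \<in> space_of E" "norm_of E x \<le> 1" using r by blast
    have "norm (f x) \<le> C * norm_of E x" using assms(2) x(2) by blast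
    also have "\<dots> \<le> C" using assms(1) x(3) by (simp add: mult_left_le)
    finally show ?thesis by (simp add: x(1))
  qed
qed

context
  assumes bf: "bounded_functional E f"
begin

lemma dual_norm_bdd_above: "bdd_above {norm (f x) |x. x \<in> space_of E \<and> norm_of E x \<le> 1}"
proof -
  obtain C where C: "\<And>x. x \<in> space_of E \<Longrightarrow> norm (f x) \<le> C * norm_of E x"
    using bf by (auto simp: bounded_functional_def)
  have "norm (f x) \<le> \<bar>C\<bar>" if "x \<in> space_of E" "norm_of E x \<le> 1" for x
  proof -
    have "norm (f x) \<le> C * norm_of E x" by (rule C[OF that(1)])
    also have "\<dots> \<le> \<bar>C\<bar> * 1"
      using that(2) normed_nonneg[OF E] by (intro mult_mono) auto
    finally show ?thesis by simp
  qed
  then show ?thesis by (intro bdd_aboveI[of _ "\<bar>C\<bar>"]) auto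
qed

lemma dual_norm_nonneg: "0 \<le> dual_norm E f"
proof -
  have "norm (f 0) \<le> dual_norm E f"
    unfolding dual_norm_def using normed_zero_mem[OF E] normed_norm_0[OF E]
    by (intro cSup_upper dual_norm_bdd_above) force
  then show ?thesis by (rule order_trans[OF norm_ge_zero])
qed

lemma dual_norm_bound:
  assumes x: "x \<in> space_of E"
  shows "norm (f x) \<le> dual_norm E f * norm_of E x"
proof (cases "x = 0")
  case True
  then show ?thesis
    using linear_functional_zero[OF f] normed_zero_mem[OF E] normed_norm_0[OF E] by simp
next
  case False
  define c where "c = inverse (norm_of E x)"
  have c: "0 < norm_of E x" using normed_pos[OF E x False] .
  have "norm (f (s (of_real c) x)) \<le> dual_norm E f"
    unfolding dual_norm_def
    using x c by (intro cSup_upper dual_norm_bdd_above)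
      (force simp: normed_scale[OF E] normed_scale_mem[OF E] c_def norm_inverse)
  moreover have "f (s (of_real c) x) = of_real c * f x"
    using f x by (simp add: linear_functional_on_def)
  ultimately have "c * norm (f x) \<le> dual_norm E f" using c by (simp add: norm_mult c_def norm_inverse)
  then show ?thesis using c by (simp add: c_def field_simps)
qed

lemma dual_norm_eq_0: "dual_norm E f = 0 \<longleftrightarrow> (\<forall>x\<in>space_of E. f x = 0)"
proof
  show "dual_norm E f = 0 \<Longrightarrow> \<forall>x\<in>space_of E. f x = 0"
    using dual_norm_bound by force
  show "\<forall>x\<in>space_of E. f x = 0 \<Longrightarrow> dual_norm E f = 0"
    using dual_norm_least[of 0] dual_norm_nonneg by force
qed

end

lemma op_norm_rank_one:
  assumes "admissible E f z"
  shows "op_norm E (\<lambda>x. s (f x) z) = dual_norm E f * norm_of E z"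
proof -
  let ?B = "{x. x \<in> space_of E \<and> norm_of E x \<le> 1}"
  let ?A = "(\<lambda>x. norm (f x)) ` ?B"
  have A: "{norm (f x) |x. x \<in> space_of E \<and> norm_of E x \<le> 1} = ?A" by auto
  have bf: "bounded_functional E f" using assms by (simp add: admissible_def)
  have eq: "norm_of E (s (f x) z) = norm_of E z * norm (f x)" if "x \<in> space_of E" for x
    using assms that normed_scale[OF E] normed_norm_0[OF E] by (auto simp: admissible_def)
  have ne: "?A \<noteq> {}"
    using normed_zero_mem[OF E] normed_norm_0[OF E] by force
  have "{norm_of E (s (f x) z) |x. x \<in> space_of E \<and> norm_of E x \<le> 1} =
      (\<lambda>x. norm_of E (s (f x) z)) ` ?B" by auto
  also have "\<dots> = (\<lambda>r. norm_of E z * r) ` ?A"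
    unfolding image_image using eq by (intro image_cong) auto
  finally have "op_norm E (\<lambda>x. s (f x) z) = (SUP r\<in>?A. norm_of E z * r)"
    by (simp add: op_norm_def)
  also have "\<dots> = norm_of E z * Sup ?A"
  proof (rule continuous_at_Sup_mono[symmetric])
    show "mono (\<lambda>r. norm_of E z * r)"
      using normed_nonneg[OF E] by (simp add: mono_def mult_left_mono)
    show "continuous (at_left (Sup ?A)) (\<lambda>r. norm_of E z * r)"
      by (intro continuous_intros)
    show "bdd_above ?A" using dual_norm_bdd_above[OF bf] by (simp only: A)
  qed (use ne in auto)
  finally show ?thesis by (simp add: dual_norm_def A mult.commute)
qed

lemma maps_boundedly_rank_one_iff:
  assumes z: "z \<noteq> 0"
  shows "maps_boundedly E (\<lambda>x. s (f x) z) \<longleftrightarrow> admissible E f z"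
proof
  assume mb: "maps_boundedly E (\<lambda>x. s (f x) z)"
  show "admissible E f z"
  proof (cases "\<forall>x\<in>space_of E. f x = 0")
    case True
    then show ?thesis by (auto simp: admissible_def bounded_functional_def intro: exI[of _ 0])
  next
    case False
    then obtain x where x: "x \<in> space_of E" "f x \<noteq> 0" by blast
    have "s (f x) z \<in> space_of E"
      using mb x(1) by (auto simp: maps_boundedly_def)
    then have "s (inverse (f x)) (s (f x) z) \<in> space_of E" by (rule normed_scale_mem[OF E])
    then have zE: "z \<in> space_of E" using x(2) by simp
    obtain C where C: "\<And>x. x \<in> space_of E \<Longrightarrow> norm_of E (s (f x) z) \<le> C * norm_of E x"
      using mb by (auto simp: maps_boundedly_def)
    have "norm (f x) \<le> C / norm_of E z * norm_of E x" if "x \<in> space_of E" for x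
      using C[OF that] normed_scale[OF E zE] normed_pos[OF E zE z] by (simp add: field_simps)
    then have "bounded_functional E f" unfolding bounded_functional_def by blast
    then show ?thesis using zE by (simp add: admissible_def)
  qed
next
  assume a: "admissible E f z"
  then obtain C where C: "\<And>x. x \<in> space_of E \<Longrightarrow> norm (f x) \<le> C * norm_of E x"
    by (auto simp: admissible_def bounded_functional_def)
  have "norm_of E (s (f x) z) \<le> (C * norm_of E z) * norm_of E x" if x: "x \<in> space_of E" for x
  proof -
    have "norm_of E (s (f x) z) = norm (f x) * norm_of E z"
      using a x normed_scale[OF E] normed_norm_0[OF E] by (auto simp: admissible_def)
    then show ?thesis
      using mult_right_mono[OF C[OF x] normed_nonneg[OF E, of z]] by (simp add: algebra_simps)
  qed
  moreover have "s (f x) z \<in> space_of E" if "x \<in> space_of E" for x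
    using a that normed_scale_mem[OF E] normed_zero_mem[OF E] by (auto simp: admissible_def)
  ultimately show "maps_boundedly E (\<lambda>x. s (f x) z)"
    by (auto simp: maps_boundedly_def)
qed

end


end

lemma couple_ops_commute: "couple_ops s X Y = couple_ops s Y X"
proof -
  have "space_of (couple_sum X Y) = space_of (couple_sum Y X)"
    by (auto simp: couple_sum_def) (metis add.commute)+
  then show ?thesis by (auto simp: couple_ops_def)
qed

lemma couple_op_norm_commute: "couple_op_norm X Y = couple_op_norm Y X"
  by (auto simp: couple_op_norm_def max.commute)

text \<open>
  All that is retained of \<open>Int\<^sub>1(X, Y) = Int\<^sub>1(V, W)\<close>: the couples have the same sum and the same
  intersection as sets, and the same bounded operators with the same norms. Compatibility of limits
  replaces the ambient Hausdorff space. These conditions are invariant under exchanging the members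
  of a couple and the two couples, so each lemma below is available in eight versions.
\<close>

locale same_operators = hahn_banach_space s
  for s :: "'k::real_normed_field \<Rightarrow> 'a::ab_group_add \<Rightarrow> 'a" +
  fixes X Y V W :: "'a nspace"
  assumes banach: "E \<in> {X, Y, V, W} \<Longrightarrow> banach_space s E"
    and compatible: "\<lbrakk>E \<in> {X, Y, V, W}; F \<in> {X, Y, V, W}; norm_lim E u x; norm_lim F u y\<rbrakk> \<Longrightarrow> x = y"
    and sum_eq: "space_of (couple_sum X Y) = space_of (couple_sum V W)"
    and inter_eq: "space_of X \<inter> space_of Y = space_of V \<inter> space_of W"
    and ops_eq: "couple_ops s X Y = couple_ops s V W"
    and op_norm_eq: "T \<in> couple_ops s X Y \<Longrightarrow> couple_op_norm X Y T = couple_op_norm V W T"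
begin

lemma normed: "E \<in> {X, Y, V, W} \<Longrightarrow> normed_space s E"
  by (rule banach_normed[OF banach])

lemma permuted:
  assumes "{X', Y', V', W'} = {X, Y, V, W}"
    and "space_of (couple_sum X' Y') = space_of (couple_sum V' W')"
    and "space_of X' \<inter> space_of Y' = space_of V' \<inter> space_of W'"
    and "couple_ops s X' Y' = couple_ops s V' W'"
    and "\<And>T. T \<in> couple_ops s X' Y' \<Longrightarrow> couple_op_norm X' Y' T = couple_op_norm V' W' T"
  shows "same_operators s X' Y' V' W'"
proof unfold_locales
  show "banach_space s E" if "E \<in> {X', Y', V', W'}" for E
    using that unfolding assms(1) by (rule banach)
  show "x = y" if "E \<in> {X', Y', V', W'}" "F \<in> {X', Y', V', W'}" "norm_lim E u x" "norm_lim F u y"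
    for E F u x y
    using that unfolding assms(1) by (rule compatible)
qed (fact assms)+

lemma swap_left: "same_operators s Y X V W"
  using sum_eq inter_eq ops_eq op_norm_eq
  by (intro permuted) (auto simp: couple_ops_commute[of s Y X] couple_op_norm_commute[of Y X]
      couple_sum_commute_space[of Y X])

lemma swap_right: "same_operators s X Y W V"
  using sum_eq inter_eq ops_eq op_norm_eq
  by (intro permuted) (auto simp: couple_ops_commute[of s W V] couple_op_norm_commute[of W V]
      couple_sum_commute_space[of W V])

lemma swap_couples: "same_operators s V W X Y"
  using sum_eq inter_eq ops_eq op_norm_eq by (intro permuted) auto

text \<open>
  The operator norm of \<open>x \<mapsto> f x z\<close> on \<open>E\<close> is the product of the dual norm of \<open>f\<close> and the norm of \<open>z\<close>.
  The identity below is the only information on norms that the whole proof extracts from the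
  equality of the operator norms.
\<close>

lemma rank_one_transfer:
  assumes f: "linear_functional_on s (space_of (couple_sum X Y)) f"
    and z: "z \<in> space_of (couple_sum X Y)" "z \<noteq> 0"
    and adm: "admissible X f z" "admissible Y f z"
  shows "admissible V f z" "admissible W f z"
    and "max (dual_norm X f * norm_of X z) (dual_norm Y f * norm_of Y z) =
         max (dual_norm V f * norm_of V z) (dual_norm W f * norm_of W z)"
proof -
  have N: "normed_space s X" "normed_space s Y" "normed_space s V" "normed_space s W"
    by (auto intro: normed)
  have lin: "linear_functional_on s (space_of E) f" if "E \<in> {X, Y, V, W}" for E
    using that couple_sum_left couple_sum_right N sum_eq
    by (intro linear_functional_on_subset[OF f]) blast
  let ?T = "\<lambda>x. s (f x) z"
  have "linear_op_on s (space_of (couple_sum X Y)) ?T"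
    using f z subspace_scale[OF subspace_couple_sum[OF N(1,2)]]
    by (auto simp: linear_op_on_def linear_functional_on_def scale_left_distrib)
  then have T: "?T \<in> couple_ops s X Y"
    using adm maps_boundedly_rank_one_iff N lin z(2) by (simp add: couple_ops_def)
  then have "maps_boundedly V ?T" "maps_boundedly W ?T"
    unfolding ops_eq by (simp_all add: couple_ops_def)
  then show adm': "admissible V f z" "admissible W f z"
    using maps_boundedly_rank_one_iff N lin z(2) by simp_all
  show "max (dual_norm X f * norm_of X z) (dual_norm Y f * norm_of Y z) =
         max (dual_norm V f * norm_of V z) (dual_norm W f * norm_of W z)"
    using op_norm_eq[OF T] op_norm_rank_one[OF N(1) lin adm(1)] op_norm_rank_one[OF N(2) lin adm(2)]
      op_norm_rank_one[OF N(3) lin adm'(1)] op_norm_rank_one[OF N(4) lin adm'(2)]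
    by (simp add: couple_op_norm_def)
qed

end

context hahn_banach_space
begin

text \<open>
  A Banach couple consists of exact interpolation spaces of itself. Hence \<open>Int\<^sub>1(X, Y) = Int\<^sub>1(V, W)\<close>
  makes every operator of one couple an operator of the other, with no larger norm.
\<close>

lemma Int1_left_right:
  assumes c: "banach_couple s X Y"
  shows "X \<in> Int1 s X Y" "Y \<in> Int1 s X Y"
proof -
  have B: "banach_space s X" "banach_space s Y"
    using c by (simp_all add: banach_couple_def)
  then have N: "normed_space s X" "normed_space s Y" by (simp_all add: banach_space_def)
  note I = couple_inter_normed[OF N] and S = couple_sum_normed[OF c]
  have "couple_inter X Y \<hookrightarrow> X" "couple_inter X Y \<hookrightarrow> Y"
    by (intro cont_embeddedI I N; simp add: couple_inter_def)+
  moreover have "X \<hookrightarrow> couple_sum X Y"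
  proof (rule cont_embeddedI[OF N(1) S])
    show "space_of X \<subseteq> space_of (couple_sum X Y)" using couple_sum_left[OF N] by blast
    show "norm_of (couple_sum X Y) x \<le> norm_of X x" if "x \<in> space_of X" for x
      using decomposition_norm_le[OF N, of 1 1 x 0] that normed_zero_mem[OF N(2)] normed_norm_0[OF N(2)]
      by (simp add: norm_couple_sum couple_sum_left[OF N])
  qed
  moreover have "Y \<hookrightarrow> couple_sum X Y"
  proof (rule cont_embeddedI[OF N(2) S])
    show "space_of Y \<subseteq> space_of (couple_sum X Y)" using couple_sum_right[OF N] by blast
    show "norm_of (couple_sum X Y) x \<le> norm_of Y x" if "x \<in> space_of Y" for x
      using decomposition_norm_le[OF N, of 1 1 0 x] that normed_zero_mem[OF N(1)] normed_norm_0[OF N(1)]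
      by (simp add: norm_couple_sum couple_sum_right[OF N])
  qed
  ultimately show "X \<in> Int1 s X Y" "Y \<in> Int1 s X Y"
    using B by (auto simp: Int1_def intermediate_spaces_def couple_ops_def couple_op_norm_def)
qed

lemma same_operators_of_Int1_eq:
  assumes c: "banach_couple s X Y" and d: "banach_couple s V W" and eq: "Int1 s X Y = Int1 s V W"
  shows "same_operators s X Y V W"
proof -
  have I: "E \<in> Int1 s X Y" "E \<in> Int1 s V W" if "E \<in> {X, Y, V, W}" for E
    using that Int1_left_right[OF c] Int1_left_right[OF d] eq by auto
  have B: "banach_space s E" if "E \<in> {X, Y, V, W}" for E
    using I[OF that] by (simp add: Int1_def intermediate_spaces_def)
  have N: "normed_space s X" "normed_space s Y" "normed_space s V" "normed_space s W"
    using B by (simp_all add: banach_space_def)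
  have sub: "space_of (couple_sum X Y) \<subseteq> space_of (couple_sum V W)"
    using I(2)[of X] I(2)[of Y] subspace_add[OF subspace_couple_sum[OF N(3,4)]]
    by (auto simp: Int1_def intermediate_spaces_def cont_embedded_def mem_couple_sum[of _ X Y] subset_iff)
  have sub': "space_of (couple_sum V W) \<subseteq> space_of (couple_sum X Y)"
    using I(1)[of V] I(1)[of W] subspace_add[OF subspace_couple_sum[OF N(1,2)]]
    by (auto simp: Int1_def intermediate_spaces_def cont_embedded_def mem_couple_sum[of _ V W] subset_iff)
  note sums = equalityI[OF sub sub']
  have inters: "space_of X \<inter> space_of Y = space_of V \<inter> space_of W"
    using I(2)[of X] I(2)[of Y] I(1)[of V] I(1)[of W]
    by (simp add: Int1_def intermediate_spaces_def cont_embedded_def) (simp add: couple_inter_def, blast)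
  have le: "T \<in> couple_ops s V W \<and> couple_op_norm V W T \<le> couple_op_norm X Y T"
    if "T \<in> couple_ops s X Y" for T
    using that I(1)[of V] I(1)[of W] sums by (auto simp: Int1_def couple_ops_def couple_op_norm_def[of V W])
  have le': "T \<in> couple_ops s X Y \<and> couple_op_norm X Y T \<le> couple_op_norm V W T"
    if "T \<in> couple_ops s V W" for T
    using that I(2)[of X] I(2)[of Y] sums by (auto simp: Int1_def couple_ops_def couple_op_norm_def[of X Y])
  have comp: "x = y" if E: "E \<in> {X, Y, V, W}" and F: "F \<in> {X, Y, V, W}"
    and u: "norm_lim E u x" "norm_lim F u y" for E F u x y
  proof -
    have emb: "G \<hookrightarrow> couple_sum X Y" "normed_space s G" if "G \<in> {X, Y, V, W}" for G
      using I[OF that] B[OF that] by (simp_all add: Int1_def intermediate_spaces_def banach_space_def)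
    show ?thesis
      using cont_embedded_norm_lim[OF emb(2)[OF E] couple_sum_normed[OF c] emb(1)[OF E] u(1)]
        cont_embedded_norm_lim[OF emb(2)[OF F] couple_sum_normed[OF c] emb(1)[OF F] u(2)]
      by (rule norm_lim_unique[OF couple_sum_normed[OF c]])
  qed
  show ?thesis
  proof unfold_locales
    show "couple_op_norm X Y T = couple_op_norm V W T" if "T \<in> couple_ops s X Y" for T
      using le[OF that] le' by force
    show "couple_ops s X Y = couple_ops s V W" using le le' by blast
  qed (fact B comp sums inters)+
qed

end

section \<open>Comparing the norms on the intersection\<close>

definition couple_functional ::
  "('k::real_normed_field \<Rightarrow> 'a::ab_group_add \<Rightarrow> 'a) \<Rightarrow> 'a nspace \<Rightarrow> 'a nspace \<Rightarrow> ('a \<Rightarrow> 'k) \<Rightarrow> bool" where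
  "couple_functional s X Y f \<longleftrightarrow>
     linear_functional_on s (space_of (couple_sum X Y)) f \<and> bounded_functional X f \<and> bounded_functional Y f"

definition proportional_on :: "'a set \<Rightarrow> ('a \<Rightarrow> real) \<Rightarrow> ('a \<Rightarrow> real) \<Rightarrow> bool" where
  "proportional_on D g h \<longleftrightarrow> (\<exists>c>0. \<forall>z\<in>D. g z = c * h z)"

lemma proportional_on_sym: "proportional_on D g h \<Longrightarrow> proportional_on D h g"
proof -
  assume "proportional_on D g h"
  then obtain c where "c > 0" "\<And>z. z \<in> D \<Longrightarrow> g z = c * h z" by (auto simp: proportional_on_def)
  then show ?thesis unfolding proportional_on_def by (intro exI[of _ "1 / c"]) auto
qed

lemma proportional_on_trans:
  "proportional_on D g h \<Longrightarrow> proportional_on D h k \<Longrightarrow> proportional_on D g k"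
proof -
  assume "proportional_on D g h" "proportional_on D h k"
  then obtain c d where "c > 0" "d > 0" "\<And>z. z \<in> D \<Longrightarrow> g z = c * h z" "\<And>z. z \<in> D \<Longrightarrow> h z = d * k z"
    by (auto simp: proportional_on_def)
  then show ?thesis unfolding proportional_on_def by (intro exI[of _ "c * d"]) auto
qed

context hahn_banach_space
begin

context
  fixes X Y :: "'a nspace" and c :: real
  assumes X: "normed_space s X" and Y: "normed_space s Y" and c: "0 < c"
    and dual: "\<And>f. couple_functional s X Y f \<Longrightarrow> c * dual_norm Y f \<le> dual_norm X f"
begin

text \<open>
  The hypothesis on dual norms says, by duality, that the unit ball of \<open>Y\<close> lies in the closure in
  \<open>X + Y\<close> of the ball of radius \<open>1 / c\<close> in \<open>X\<close>. The error of the approximation is an element of \<open>X + Y\<close>;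
  its part in \<open>X\<close> can be added to the approximating element, so that the remaining error lies in \<open>Y\<close>
  and the step can be iterated. The seminorm to which Hahn--Banach is applied has as weights the
  reciprocals of the two permitted radii, so that a decomposition \<open>y = x + y'\<close> whose weighted norm is
  less than the norm of \<open>y\<close> would be of the required kind.
\<close>

lemma approximate_from_dual_norm_le:
  assumes e: "0 < e" and y: "y \<in> space_of Y"
  shows "\<exists>x\<in>space_of X. y - x \<in> space_of Y \<and>
    norm_of X x \<le> (1 / c + e) * norm_of Y y \<and> norm_of Y (y - x) \<le> e * norm_of Y y"
proof (rule ccontr)
  assume no: "\<not> ?thesis"
  have "y \<noteq> 0"
    using no normed_zero_mem[OF X] normed_zero_mem[OF Y] normed_norm_0[OF X] normed_norm_0[OF Y] by force
  then have pos: "0 < norm_of Y y" using normed_pos[OF Y y] by blast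
  \<comment> \<open>With \<open>a < c\<close>, a functional of dual norm at least \<open>1\<close> on \<open>Y\<close> and at most \<open>a\<close> on \<open>X\<close> violates the hypothesis.\<close>
  define a where "a = 1 / (1 / c + e)"
  define b where "b = 1 / e"
  have ab: "0 < a" "0 < b" using c e by (simp_all add: a_def b_def add_pos_pos)
  have ac: "a < c"
    using c e by (simp add: a_def field_simps add_pos_pos)
  let ?q = "decomposition_norm a b X Y"
  note ab0 = ab[THEN less_imp_le]
  have "norm_of Y y \<le> ?q y"
  proof (rule decomposition_norm_greatest[OF X Y ab0 couple_sum_right[OF X Y y]])
    fix x y' assume xy: "x \<in> space_of X" "y' \<in> space_of Y" "y = x + y'"
    then have "(1 / c + e) * norm_of Y y < norm_of X x \<or> e * norm_of Y y < norm_of Y y'"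
      using no by (metis add_diff_cancel_left' not_le)
    then have "norm_of Y y \<le> a * norm_of X x \<or> norm_of Y y \<le> b * norm_of Y y'"
    proof
      assume "(1 / c + e) * norm_of Y y < norm_of X x"
      then have "a * ((1 / c + e) * norm_of Y y) \<le> a * norm_of X x"
        using ab0(1) by (intro mult_left_mono) auto
      moreover have "a * (1 / c + e) = 1"
        using ab(1) unfolding a_def by (metis divide_eq_0_iff less_irrefl nonzero_eq_divide_eq)
      ultimately show ?thesis by (metis mult.assoc mult_1)
    next
      assume "e * norm_of Y y < norm_of Y y'"
      then show ?thesis using e by (simp add: b_def field_simps)
    qed
    then show "norm_of Y y \<le> a * norm_of X x + b * norm_of Y y'"
      using ab0 normed_nonneg[OF X, of x] normed_nonneg[OF Y, of y']
      by (smt (verit) mult_nonneg_nonneg)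
  qed
  moreover obtain f where f: "linear_functional_on s (space_of (couple_sum X Y)) f"
    "\<And>w. w \<in> space_of (couple_sum X Y) \<Longrightarrow> norm (f w) \<le> ?q w" "?q y \<le> norm (f y)"
    using hahn_banach[OF subspace_couple_sum[OF X Y] seminorm_decomposition[OF X Y ab0]
        couple_sum_right[OF X Y y]] by blast
  ultimately have fy: "norm_of Y y \<le> norm (f y)" by linarith
  have fX: "norm (f x) \<le> a * norm_of X x" if "x \<in> space_of X" for x
    using f(2)[OF couple_sum_left[OF X Y that]] decomposition_norm_le[OF X Y ab0 that normed_zero_mem[OF Y]]
      normed_norm_0[OF Y] by simp
  have fY: "norm (f x) \<le> b * norm_of Y x" if "x \<in> space_of Y" for x
    using f(2)[OF couple_sum_right[OF X Y that]] decomposition_norm_le[OF X Y ab0 normed_zero_mem[OF X] that]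
      normed_norm_0[OF X] by simp
  have lin: "linear_functional_on s (space_of X) f" "linear_functional_on s (space_of Y) f"
    using couple_sum_left[OF X Y] couple_sum_right[OF X Y]
    by (auto intro: linear_functional_on_subset[OF f(1)])
  have bd: "bounded_functional X f" "bounded_functional Y f"
    using fX fY by (auto simp: bounded_functional_def)
  have "1 * norm_of Y y \<le> dual_norm Y f * norm_of Y y"
    using fy dual_norm_bound[OF Y lin(2) bd(2) y] by simp
  then have "1 \<le> dual_norm Y f" using pos by (simp only: mult_le_cancel_right_pos)
  then have "c * 1 \<le> c * dual_norm Y f" using c by (intro mult_left_mono) auto
  also have "\<dots> \<le> dual_norm X f" using f(1) bd by (intro dual) (simp add: couple_functional_def)
  also have "\<dots> \<le> a" by (rule dual_norm_least[OF X lin(1) ab0(1) fX])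
  finally show False using ac by simp
qed

text \<open>
  As in the proof of the open mapping theorem, the approximation is iterated: the errors \<open>u n\<close> tend to
  \<open>0\<close> in \<open>Y\<close> geometrically, while their increments are summable in \<open>X\<close>. Completeness of \<open>X\<close> and
  compatibility of the limits show that they tend to \<open>0\<close> in \<open>X\<close> as well, which bounds \<open>y = u 0\<close>.
\<close>

lemma norm_le_of_dual_norm_le:
  assumes banach: "banach_space s X"
    and compatible: "\<And>u x y. norm_lim X u x \<Longrightarrow> norm_lim Y u y \<Longrightarrow> x = y"
    and yX: "y \<in> space_of X" and yY: "y \<in> space_of Y"
  shows "c * norm_of X y \<le> norm_of Y y"
proof -
  have approx: "(1 - e) * norm_of X y \<le> (1 / c + e) * norm_of Y y" if e: "0 < e" "e < 1" for e
  proof -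
    define K where "K = 1 / c + e"
    define B where "B = K * norm_of Y y / (1 - e)"
    have K: "0 \<le> K" using c e by (simp add: K_def)
    have B0: "0 \<le> B" using K e normed_nonneg[OF Y] by (simp add: B_def)
    have "\<forall>y\<in>space_of Y. \<exists>x\<in>space_of X. y - x \<in> space_of Y \<and>
        norm_of X x \<le> K * norm_of Y y \<and> norm_of Y (y - x) \<le> e * norm_of Y y"
      using approximate_from_dual_norm_le[OF e(1)] by (simp add: K_def)
    then obtain g where g: "\<And>y. y \<in> space_of Y \<Longrightarrow> g y \<in> space_of X \<and> y - g y \<in> space_of Y \<and>
        norm_of X (g y) \<le> K * norm_of Y y \<and> norm_of Y (y - g y) \<le> e * norm_of Y y"
      by metis
    define u where "u n = ((\<lambda>y. y - g y) ^^ n) y" for n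
    have u_Suc: "u (Suc n) = u n - g (u n)" and u_0: "u 0 = y" for n by (simp_all add: u_def)
    have u: "u n \<in> space_of X \<and> u n \<in> space_of Y \<and> norm_of Y (u n) \<le> e ^ n * norm_of Y y" for n
    proof (induction n)
      case 0
      then show ?case using yX yY by (simp add: u_0)
    next
      case (Suc n)
      have "norm_of Y (u (Suc n)) \<le> e * norm_of Y (u n)" using g Suc by (simp add: u_Suc)
      also have "\<dots> \<le> e * (e ^ n * norm_of Y y)" using Suc e by (intro mult_left_mono) auto
      finally show ?case using g Suc normed_diff_mem[OF X] by (simp add: u_Suc mult.assoc)
    qed
    have step: "norm_of X (u n - u (Suc n)) \<le> B * (e ^ n - e ^ Suc n)" for n
    proof -
      have "norm_of X (u n - u (Suc n)) \<le> K * norm_of Y (u n)" using g u by (simp add: u_Suc)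
      also have "\<dots> \<le> K * (e ^ n * norm_of Y y)" using u K by (intro mult_left_mono) auto
      also have "\<dots> = B * (e ^ n - e ^ Suc n)" using e by (simp add: B_def field_simps)
      finally show ?thesis .
    qed
    have dist: "norm_of X (u n - u (n + k)) \<le> B * (e ^ n - e ^ (n + k))" for n k
    proof (induction k)
      case 0
      then show ?case using normed_norm_0[OF X] by simp
    next
      case (Suc k)
      have "norm_of X (u n - u (n + Suc k)) \<le>
          norm_of X (u n - u (n + k)) + norm_of X (u (n + k) - u (n + Suc k))"
        using u by (intro normed_diff_triangle X) auto
      also have "\<dots> \<le> B * (e ^ n - e ^ (n + k)) + B * (e ^ (n + k) - e ^ (n + Suc k))"
        using Suc step[of "n + k"] by simp
      finally show ?case by (simp add: algebra_simps)
    qed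
    have dist': "norm_of X (u n - u m) \<le> B * e ^ n" if "n \<le> m" for n m
    proof -
      have "norm_of X (u n - u m) \<le> B * (e ^ n - e ^ m)" using dist[of n "m - n"] that by simp
      also have "\<dots> \<le> B * e ^ n" using B0 e by (intro mult_left_mono) auto
      finally show ?thesis .
    qed
    have e_lim: "(\<lambda>n. C * e ^ n) \<longlonglongrightarrow> 0" for C
      using tendsto_mult_right_zero[OF LIMSEQ_realpow_zero[of e]] e by simp
    obtain x where x: "norm_lim X u x"
    proof (rule banach_complete[OF banach])
      fix d :: real assume d: "0 < d"
      obtain N where N: "\<And>n. N \<le> n \<Longrightarrow> B * e ^ n < d"
        using order_tendstoD(2)[OF e_lim[of B] d] by (auto simp: eventually_sequentially)
      have "norm_of X (u m - u n) < d" if "N \<le> m" "N \<le> n" for m n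
      proof (cases "m \<le> n")
        case True
        then show ?thesis using dist'[OF True] N[OF that(1)] by linarith
      next
        case False
        then show ?thesis using dist'[of n m] N[OF that(2)] normed_diff_commute[OF X, of "u m"] by simp
      qed
      then show "\<exists>N. \<forall>m\<ge>N. \<forall>n\<ge>N. norm_of X (u m - u n) < d" by blast
    qed (use u in auto)
    have "(\<lambda>n. norm_of Y (u n)) \<longlonglongrightarrow> 0"
      using u normed_nonneg[OF Y] e_lim[of "norm_of Y y"]
      by (intro tendsto_sandwich[OF _ _ tendsto_const e_lim[of "norm_of Y y"]])
        (auto simp: mult.commute)
    then have "norm_lim Y u 0"
      using u normed_zero_mem[OF Y] by (auto simp: norm_lim_def)
    then have "x = 0" using compatible x by blast
    then have lim: "(\<lambda>n. norm_of X (u n)) \<longlonglongrightarrow> 0"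
      using norm_lim_norm[OF X x] normed_norm_0[OF X] by simp
    have "norm_of X y \<le> B + norm_of X (u n)" for n
      using dist'[of 0 n] normed_triangle[OF X, of "y - u n" "u n"] u yX normed_diff_mem[OF X]
      by (fastforce simp: u_0)
    then have "norm_of X y \<le> B + 0"
      by (intro LIMSEQ_le_const[OF tendsto_add[OF tendsto_const lim]]) blast
    then show ?thesis using e by (simp add: B_def K_def field_simps)
  qed
  have "((\<lambda>e. (1 - e) * norm_of X y) \<longlongrightarrow> (1 - 0) * norm_of X y) (at_right 0)"
    "((\<lambda>e. (1 / c + e) * norm_of Y y) \<longlongrightarrow> (1 / c + 0) * norm_of Y y) (at_right 0)"
    by (intro tendsto_intros)+
  moreover have "\<forall>\<^sub>F e in at_right (0::real). (1 - e) * norm_of X y \<le> (1 / c + e) * norm_of Y y"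
    unfolding eventually_at_right_field using approx by (intro exI[of _ 1]) auto
  ultimately have "(1 - 0) * norm_of X y \<le> (1 / c + 0) * norm_of Y y"
    by (intro tendsto_le[of "at_right (0::real)"]) auto
  then show ?thesis using c by (simp add: field_simps)
qed

end

end

context same_operators
begin

lemma couple_functional_linear:
  assumes "couple_functional s X Y f" "E \<in> {X, Y, V, W}"
  shows "linear_functional_on s (space_of E) f"
proof (rule linear_functional_on_subset)
  show "linear_functional_on s (space_of (couple_sum X Y)) f"
    using assms(1) by (simp add: couple_functional_def)
  have "normed_space s X" "normed_space s Y" "normed_space s V" "normed_space s W"
    by (simp_all add: normed)
  then have "space_of X \<subseteq> space_of (couple_sum X Y)" "space_of Y \<subseteq> space_of (couple_sum X Y)"
    "space_of V \<subseteq> space_of (couple_sum V W)" "space_of W \<subseteq> space_of (couple_sum V W)"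
    by (auto intro: couple_sum_left couple_sum_right)
  then show "space_of E \<subseteq> space_of (couple_sum X Y)" using assms(2) sum_eq by auto
qed

text \<open>
  Divided by the dual norm of \<open>f\<close> on \<open>Y\<close>, the identity for rank one operators reads
  \<open>max (r |z|\<^sub>X) |z|\<^sub>Y = max (p |z|\<^sub>V) (q |z|\<^sub>W)\<close>, where \<open>r\<close> is the quotient of the dual norms of \<open>f\<close> on
  \<open>X\<close> and \<open>Y\<close>. Let \<open>r\<close> tend to its infimum \<open>I\<close>. By \<open>norm_le_of_dual_norm_le\<close>, \<open>I |z|\<^sub>X \<le> |z|\<^sub>Y\<close>, so that the left
  side tends to \<open>|z|\<^sub>Y\<close>, and a compactness argument yields limits of \<open>p\<close> and \<open>q\<close>.
\<close>

lemma right_norm_is_max: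
  assumes z0: "z0 \<in> space_of X \<inter> space_of Y" "z0 \<noteq> 0"
  obtains p q where "0 \<le> p" "0 \<le> q"
    "\<And>z. z \<in> space_of X \<inter> space_of Y \<Longrightarrow> norm_of Y z = max (p * norm_of V z) (q * norm_of W z)"
proof -
  have X: "normed_space s X" and Y: "normed_space s Y" and V: "normed_space s V" and W: "normed_space s W"
    by (auto intro: normed)
  define R where "R = {dual_norm X f / dual_norm Y f |f. couple_functional s X Y f \<and> dual_norm Y f \<noteq> 0}"
  note lin = couple_functional_linear
  have dn: "0 \<le> dual_norm X f" "0 \<le> dual_norm Y f" if "couple_functional s X Y f" for f
    using that lin[OF that] dual_norm_nonneg X Y by (auto simp: couple_functional_def)
  have le: "c * norm_of X z \<le> norm_of Y z"
    if "0 < c" "\<And>r. r \<in> R \<Longrightarrow> c \<le> r" "z \<in> space_of X \<inter> space_of Y" for c z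
  proof (rule norm_le_of_dual_norm_le[OF X Y that(1)])
    show "c * dual_norm Y f \<le> dual_norm X f" if f: "couple_functional s X Y f" for f
    proof (cases "dual_norm Y f = 0")
      case True
      then show ?thesis using dn[OF f] by simp
    next
      case False
      then have "c \<le> dual_norm X f / dual_norm Y f" using that f \<open>\<And>r. r \<in> R \<Longrightarrow> c \<le> r\<close> by (auto simp: R_def)
      then show ?thesis using dn(2)[OF f] False by (simp add: field_simps)
    qed
    show "x = y" if "norm_lim X u x" "norm_lim Y u y" for u x y
      by (rule compatible[OF _ _ that]) auto
  qed (use banach that in auto)
  have R0: "0 \<le> r" if "r \<in> R" for r using that dn by (auto simp: R_def)
  have "R \<noteq> {}"
  proof
    assume "R = {}"
    \<comment> \<open>Every constant is then a lower bound of \<open>R\<close>; this one is too large for \<open>z0\<close>.\<close>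
    then have "(norm_of Y z0 / norm_of X z0 + 1) * norm_of X z0 \<le> norm_of Y z0"
      using z0 normed_nonneg[OF X] normed_nonneg[OF Y] by (intro le) (auto intro: add_nonneg_pos)
    moreover have "0 < norm_of X z0" using normed_pos[OF X] z0 by auto
    ultimately show False by (simp add: field_simps mult_le_0_iff)
  qed
  define I where "I = Inf R"
  have I_le: "I \<le> r" if "r \<in> R" for r
    unfolding I_def using that R0 by (intro cInf_lower bdd_belowI)
  have I0: "0 \<le> I" unfolding I_def using R0 \<open>R \<noteq> {}\<close> by (intro cInf_greatest)
  have XY: "I * norm_of X z \<le> norm_of Y z" if "z \<in> space_of X \<inter> space_of Y" for z
    using le[OF _ I_le that] I0 normed_nonneg[OF Y, of z] by (cases "I = 0") auto
  have "\<exists>f. couple_functional s X Y f \<and> dual_norm Y f \<noteq> 0 \<and>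
      dual_norm X f / dual_norm Y f < I + inverse (real (Suc n))" for n
  proof -
    have "Inf R < I + inverse (real (Suc n))" by (simp add: I_def)
    then obtain r where "r \<in> R" "r < I + inverse (real (Suc n))"
      using cInf_lessD[OF \<open>R \<noteq> {}\<close>] by blast
    then show ?thesis by (auto simp: R_def)
  qed
  then obtain f where f: "\<And>n. couple_functional s X Y (f n)" "\<And>n. dual_norm Y (f n) \<noteq> 0"
    "\<And>n. dual_norm X (f n) / dual_norm Y (f n) < I + inverse (real (Suc n))" by metis
  define r where "r n = dual_norm X (f n) / dual_norm Y (f n)" for n
  define p where "p n = dual_norm V (f n) / dual_norm Y (f n)" for n
  define q where "q n = dual_norm W (f n) / dual_norm Y (f n)" for n
  have "r \<longlonglongrightarrow> I + 0"
  proof (rule tendsto_sandwich)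
    show "\<forall>\<^sub>F n in sequentially. I \<le> r n"
      unfolding r_def using f(1,2) by (intro always_eventually allI I_le) (auto simp: R_def)
    show "\<forall>\<^sub>F n in sequentially. r n \<le> I + inverse (real (Suc n))"
      using f(3) by (simp add: r_def less_imp_le)
    show "(\<lambda>n. I + inverse (real (Suc n))) \<longlonglongrightarrow> I + 0"
      by (intro tendsto_add tendsto_const LIMSEQ_inverse_real_of_nat)
  qed auto
  then have r: "r \<longlonglongrightarrow> I" by simp
  have fpos: "0 < dual_norm Y (f n)" for n using dn(2)[OF f(1)] f(2)[of n] by (simp add: less_le)
  have tr: "admissible V (f n) z" "admissible W (f n) z"
    "max (dual_norm X (f n) * norm_of X z) (dual_norm Y (f n) * norm_of Y z) =
     max (dual_norm V (f n) * norm_of V z) (dual_norm W (f n) * norm_of W z)"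
    if "z \<in> space_of X \<inter> space_of Y" "z \<noteq> 0" for n z
    using rank_one_transfer[of "f n" z] f(1)[of n] that couple_sum_left[OF X Y]
    by (auto simp: couple_functional_def admissible_def)
  have eq: "max (r n * norm_of X z) (norm_of Y z) = max (p n * norm_of V z) (q n * norm_of W z)"
    if z: "z \<in> space_of X \<inter> space_of Y" for z n
  proof (cases "z = 0")
    case True
    then show ?thesis using normed_norm_0 X Y V W by simp
  next
    case False
    have "max (dual_norm X (f n) * norm_of X z) (dual_norm Y (f n) * norm_of Y z) / dual_norm Y (f n) =
      max (dual_norm V (f n) * norm_of V z) (dual_norm W (f n) * norm_of W z) / dual_norm Y (f n)"
      using tr(3)[OF z False] by simp
    then show ?thesis
      using fpos[of n] by (simp add: max_divide_distrib_right r_def p_def q_def)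
  qed
  have pq0: "0 \<le> p n" "0 \<le> q n" for n
    using tr(1,2)[OF z0, of n] dual_norm_nonneg[OF V lin[OF f(1)]] dual_norm_nonneg[OF W lin[OF f(1)]] fpos[of n]
    by (simp_all add: p_def q_def admissible_def)
  have lim: "(\<lambda>n. max (r n * norm_of X z) (norm_of Y z)) \<longlonglongrightarrow> norm_of Y z"
    if z: "z \<in> space_of X \<inter> space_of Y" for z
  proof -
    have "(\<lambda>n. max (r n * norm_of X z) (norm_of Y z)) \<longlonglongrightarrow> max (I * norm_of X z) (norm_of Y z)"
      by (intro tendsto_intros r)
    then show ?thesis using XY[OF z] by (simp add: max_absorb2)
  qed
  obtain M where M: "\<And>n. max (r n * norm_of X z0) (norm_of Y z0) \<le> M"
    using convergent_imp_Bseq[OF convergentI[OF lim[OF z0(1)]]] by (auto simp: Bseq_def abs_le_iff)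
  have z0pos: "0 < norm_of V z0" "0 < norm_of W z0"
    using z0 normed_pos[OF V] normed_pos[OF W] inter_eq by auto
  have "p n \<le> M / norm_of V z0 \<and> q n \<le> M / norm_of W z0" for n
    using M[of n] eq[OF z0(1), of n] z0pos by (simp add: field_simps)
  then have mem: "(p n, q n) \<in> {0..M / norm_of V z0} \<times> {0..M / norm_of W z0}" for n
    using pq0[of n] by simp
  have "seq_compact ({0..M / norm_of V z0} \<times> {0..M / norm_of W z0})"
    by (intro compact_imp_seq_compact compact_Times compact_Icc)
  then obtain l k where l: "l \<in> {0..M / norm_of V z0} \<times> {0..M / norm_of W z0}"
    and k: "strict_mono (k :: nat \<Rightarrow> nat)" and pqk: "((\<lambda>n. (p n, q n)) \<circ> k) \<longlonglongrightarrow> l"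
    by (rule seq_compactE) (use mem in auto)
  define p' where "p' = fst l"
  define q' where "q' = snd l"
  have pq: "(\<lambda>n. p (k n)) \<longlonglongrightarrow> p'" "(\<lambda>n. q (k n)) \<longlonglongrightarrow> q'"
    using tendsto_fst[OF pqk] tendsto_snd[OF pqk] by (simp_all add: comp_def p'_def q'_def)
  have pq'0: "0 \<le> p'" "0 \<le> q'" using l by (auto simp: p'_def q'_def)
  have "norm_of Y z = max (p' * norm_of V z) (q' * norm_of W z)"
    if z: "z \<in> space_of X \<inter> space_of Y" for z
  proof (rule LIMSEQ_unique)
    show "(\<lambda>n. max (p (k n) * norm_of V z) (q (k n) * norm_of W z)) \<longlonglongrightarrow> norm_of Y z"
      using LIMSEQ_subseq_LIMSEQ[OF lim[OF z] k] eq[OF z] by (simp add: comp_def)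
    show "(\<lambda>n. max (p (k n) * norm_of V z) (q (k n) * norm_of W z)) \<longlonglongrightarrow>
        max (p' * norm_of V z) (q' * norm_of W z)"
      by (intro tendsto_intros pq)
  qed
  then show thesis using that pq'0 by blast
qed

end

text \<open>
  Substituting the formulas for \<open>v\<close> and \<open>w\<close> gives \<open>x = max (l x) (m y)\<close> with
  \<open>l = max (a a1) (b a2)\<close>. If \<open>l < 1\<close> then \<open>x = m y\<close> everywhere, which is excluded. So one of the two
  products, say \<open>a a1\<close>, is at least \<open>1\<close>, and then \<open>x \<ge> a v \<ge> a a1 x \<ge> x\<close>.
\<close>

lemma proportional_of_mutual_max:
  fixes x y v w :: "'a \<Rightarrow> real"
  assumes pos: "\<And>z. z \<in> D \<Longrightarrow> 0 < x z" and ne: "D \<noteq> {}"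
    and nonneg: "0 \<le> a" "0 \<le> b"
    and x: "\<And>z. z \<in> D \<Longrightarrow> x z = max (a * v z) (b * w z)"
    and v: "\<And>z. z \<in> D \<Longrightarrow> v z = max (a1 * x z) (b1 * y z)"
    and w: "\<And>z. z \<in> D \<Longrightarrow> w z = max (a2 * x z) (b2 * y z)"
    and not: "\<not> proportional_on D x y" and ypos: "\<And>z. z \<in> D \<Longrightarrow> 0 < y z"
  shows "proportional_on D x v \<or> proportional_on D x w"
proof -
  define l where "l = max (a * a1) (b * a2)"
  define m where "m = max (a * b1) (b * b2)"
  have lm: "x z = max (l * x z) (m * y z)" if z: "z \<in> D" for z
    using x[OF z] v[OF z] w[OF z] nonneg pos[OF z] ypos[OF z]
    by (simp add: l_def m_def max_mult_distrib_left max_mult_distrib_right mult.assoc max.assoc max.left_commute)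
  have "1 \<le> l"
  proof (rule ccontr)
    assume l: "\<not> 1 \<le> l"
    have xy: "x z = m * y z" if z: "z \<in> D" for z
    proof -
      have "l * x z < 1 * x z" using l pos[OF z] by (intro mult_strict_right_mono) auto
      then show ?thesis using lm[OF z] by linarith
    qed
    obtain z where "z \<in> D" using ne by blast
    then have "0 < m" using xy pos[of z] ypos[of z] by (metis zero_less_mult_pos2)
    then show False using xy not by (auto simp: proportional_on_def)
  qed
  then consider "1 \<le> a * a1" | "1 \<le> b * a2" by (auto simp: l_def le_max_iff_disj)
  then show ?thesis
  proof cases
    case 1
    have "x z = a * v z" if z: "z \<in> D" for z
    proof (rule antisym)
      show "a * v z \<le> x z" using x[OF z] by simp
      have "x z * 1 \<le> x z * (a * a1)" using 1 pos[OF z] by (intro mult_left_mono) auto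
      also have "\<dots> \<le> a * v z" using mult_left_mono[OF max.cobounded1 nonneg(1), of "a1 * x z" "b1 * y z"] v[OF z]
        by (simp add: algebra_simps)
      finally show "x z \<le> a * v z" by simp
    qed
    moreover have "0 < a" using 1 nonneg by (cases "a = 0") auto
    ultimately show ?thesis by (auto simp: proportional_on_def)
  next
    case 2
    have "x z = b * w z" if z: "z \<in> D" for z
    proof (rule antisym)
      show "b * w z \<le> x z" using x[OF z] by simp
      have "x z * 1 \<le> x z * (b * a2)" using 2 pos[OF z] by (intro mult_left_mono) auto
      also have "\<dots> \<le> b * w z" using mult_left_mono[OF max.cobounded1 nonneg(2), of "a2 * x z" "b2 * y z"] w[OF z]
        by (simp add: algebra_simps)
      finally show "x z \<le> b * w z" by simp
    qed
    moreover have "0 < b" using 2 nonneg by (cases "b = 0") auto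
    ultimately show ?thesis by (auto simp: proportional_on_def)
  qed
qed

text \<open>
  If \<open>x\<close> and \<open>y\<close> are proportional, the formulas for \<open>v\<close> and \<open>w\<close> make all four functions proportional.
  Otherwise each of \<open>x\<close> and \<open>y\<close> is proportional to \<open>v\<close> or to \<open>w\<close>, and they cannot share a partner.
\<close>

lemma matching_of_mutual_max:
  fixes x y v w :: "'a \<Rightarrow> real"
  assumes pos: "\<And>z. z \<in> D \<Longrightarrow> 0 < x z \<and> 0 < y z \<and> 0 < v z \<and> 0 < w z"
    and nonneg: "0 \<le> a" "0 \<le> b" "0 \<le> a'" "0 \<le> b'"
    and x: "\<And>z. z \<in> D \<Longrightarrow> x z = max (a * v z) (b * w z)"
    and y: "\<And>z. z \<in> D \<Longrightarrow> y z = max (a' * v z) (b' * w z)"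
    and v: "\<And>z. z \<in> D \<Longrightarrow> v z = max (c * x z) (d * y z)"
    and w: "\<And>z. z \<in> D \<Longrightarrow> w z = max (c' * x z) (d' * y z)"
  shows "(proportional_on D x v \<and> proportional_on D y w) \<or> (proportional_on D x w \<and> proportional_on D y v)"
proof (cases "D = {}")
  case True
  then show ?thesis by (auto simp: proportional_on_def intro: exI[of _ 1])
next
  case False
  then obtain z0 where z0: "z0 \<in> D" by blast
  show ?thesis
  proof (cases "proportional_on D x y")
    case True
    then obtain k where k: "0 < k" "\<And>z. z \<in> D \<Longrightarrow> x z = k * y z" by (auto simp: proportional_on_def)
    have *: "proportional_on D g y"
      if g: "\<And>z. z \<in> D \<Longrightarrow> g z = max (e * x z) (e' * y z)" "\<And>z. z \<in> D \<Longrightarrow> 0 < g z" for g e e'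
    proof -
      have "g z = max (e * k) e' * y z" if z: "z \<in> D" for z
        using g(1)[OF z] k(2)[OF z] pos[OF z] by (simp add: max_mult_distrib_right mult.assoc)
      moreover from this[OF z0] have "0 < max (e * k) e'"
        using g(2)[OF z0] pos[OF z0] by (metis zero_less_mult_pos2)
      ultimately show ?thesis unfolding proportional_on_def by blast
    qed
    have "proportional_on D v y" "proportional_on D w y" using *[OF v] *[OF w] pos by blast+
    then show ?thesis using True proportional_on_sym proportional_on_trans by blast
  next
    case no: False
    have "proportional_on D x v \<or> proportional_on D x w"
      by (rule proportional_of_mutual_max[OF _ False nonneg(1,2) x v w no]) (use pos in blast)+
    moreover have "proportional_on D y v \<or> proportional_on D y w"
    proof (rule proportional_of_mutual_max[OF _ False nonneg(3,4) y])
      show "v z = max (d * y z) (c * x z)" "w z = max (d' * y z) (c' * x z)" if "z \<in> D" for z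
        using v[OF that] w[OF that] by (simp_all add: max.commute)
    qed (use pos no proportional_on_sym in blast)+
    ultimately show ?thesis using no proportional_on_sym proportional_on_trans by blast
  qed
qed

section \<open>From the intersection to the whole spaces\<close>

definition dense_in :: "'a::ab_group_add nspace \<Rightarrow> 'a set \<Rightarrow> bool" where
  "dense_in E D \<longleftrightarrow> (\<forall>x\<in>space_of E. \<forall>e>0. \<exists>d\<in>D. norm_of E (x - d) < e)"

lemma norm_proportional_iff:
  "E \<cong>\<^sub>n F \<longleftrightarrow> space_of E = space_of F \<and> proportional_on (space_of E) (norm_of E) (norm_of F)"
  by (simp add: norm_proportional_def proportional_on_def)

lemma norm_proportional_sym: "E \<cong>\<^sub>n F \<Longrightarrow> F \<cong>\<^sub>n E"
  by (auto simp: norm_proportional_iff intro: proportional_on_sym)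

lemma norm_proportional_trans: "E \<cong>\<^sub>n F \<Longrightarrow> F \<cong>\<^sub>n G \<Longrightarrow> E \<cong>\<^sub>n G"
  by (auto simp: norm_proportional_iff intro: proportional_on_trans)

context scalar_space
begin

lemma norm_lim_in_dense_set:
  assumes E: "normed_space s E" and "dense_in E D" "D \<subseteq> space_of E" "x \<in> space_of E"
  obtains u where "range u \<subseteq> D" "norm_lim E u x"
proof -
  have "\<exists>d\<in>D. norm_of E (x - d) < inverse (real (Suc n))" for n
    using assms(2,4) by (auto simp: dense_in_def)
  then obtain u where u: "\<And>n. u n \<in> D" "\<And>n. norm_of E (x - u n) < inverse (real (Suc n))" by metis
  have "(\<lambda>n. norm_of E (u n - x)) \<longlonglongrightarrow> 0"
  proof (rule tendsto_sandwich[OF _ _ tendsto_const LIMSEQ_inverse_real_of_nat])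
    have "norm_of E (u n - x) \<le> inverse (real (Suc n))" for n
      using u(2)[of n] normed_diff_commute[OF E, of x "u n"] by linarith
    then show "\<forall>\<^sub>F n in sequentially. norm_of E (u n - x) \<le> inverse (real (Suc n))"
      by (intro always_eventually allI)
  qed (use normed_nonneg[OF E] in auto)
  then show thesis using that[of u] u(1) assms by (auto simp: norm_lim_def)
qed

lemma norm_lim_cauchy:
  assumes E: "normed_space s E" and u: "norm_lim E u x" and e: "0 < e"
  shows "\<exists>N. \<forall>m\<ge>N. \<forall>n\<ge>N. norm_of E (u m - u n) < e"
proof -
  have "(\<lambda>n. norm_of E (u n - x)) \<longlonglongrightarrow> 0" using u by (simp add: norm_lim_def)
  then obtain N where N: "\<And>n. N \<le> n \<Longrightarrow> norm_of E (u n - x) < e / 2"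
    using order_tendstoD(2)[of _ 0 sequentially "e / 2"] e by (auto simp: eventually_sequentially)
  have "norm_of E (u m - u n) < e" if "N \<le> m" "N \<le> n" for m n
  proof -
    have "norm_of E (u m - u n) \<le> norm_of E (u m - x) + norm_of E (x - u n)"
      using u by (intro normed_diff_triangle E) (auto simp: norm_lim_def)
    then show ?thesis using N[OF that(1)] N[OF that(2)] normed_diff_commute[OF E, of x "u n"] by simp
  qed
  then show ?thesis by blast
qed

text \<open>
  An element of \<open>E\<close> is the limit of a sequence in \<open>D\<close>, which is also Cauchy in \<open>F\<close>. Compatibility
  identifies its limit in \<open>F\<close> with the given element.
\<close>

lemma proportional_extend_subset:
  assumes E: "normed_space s E" and F: "banach_space s F"
    and compatible: "\<And>u x y. norm_lim E u x \<Longrightarrow> norm_lim F u y \<Longrightarrow> x = y"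
    and dense: "dense_in E D" and D: "D \<subseteq> space_of E" "D \<subseteq> space_of F"
    and c: "0 < c" "\<And>z. z \<in> D \<Longrightarrow> norm_of E z = c * norm_of F z"
    and diff: "\<And>x y. x \<in> D \<Longrightarrow> y \<in> D \<Longrightarrow> x - y \<in> D"
    and x: "x \<in> space_of E"
  shows "x \<in> space_of F \<and> norm_of E x = c * norm_of F x"
proof -
  note N = banach_normed[OF F]
  obtain u where u: "range u \<subseteq> D" "norm_lim E u x"
    using norm_lim_in_dense_set[OF E dense D(1) x] by blast
  obtain y where y: "norm_lim F u y"
  proof (rule banach_complete[OF F])
    show "range u \<subseteq> space_of F" using u D by blast
    show "\<exists>N. \<forall>m\<ge>N. \<forall>n\<ge>N. norm_of F (u m - u n) < e" if e: "0 < e" for e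
    proof -
      have "u m - u n \<in> D" for m n using diff u(1) by blast
      then have "norm_of E (u m - u n) = c * norm_of F (u m - u n)" for m n by (rule c(2))
      then show ?thesis using norm_lim_cauchy[OF E u(2), of "c * e"] c(1) e by simp
    qed
  qed
  have xy: "x = y" using compatible u(2) y by blast
  have "(\<lambda>n. norm_of E (u n)) \<longlonglongrightarrow> c * norm_of F y"
    using tendsto_mult_left[OF norm_lim_norm[OF N y], of c] u(1) c(2) by (simp add: image_subset_iff)
  then have "norm_of E x = c * norm_of F y"
    using norm_lim_norm[OF E u(2)] by (rule LIMSEQ_unique[rotated])
  then show ?thesis using y xy by (simp add: norm_lim_def)
qed

end

context same_operators
begin

abbreviation "intersection \<equiv> space_of X \<inter> space_of Y"

lemma proportional_extend:
  assumes EF: "E \<in> {X, Y, V, W}" "F \<in> {X, Y, V, W}"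
    and dense: "dense_in E intersection" "dense_in F intersection"
    and ratio: "proportional_on intersection (norm_of E) (norm_of F)"
  shows "E \<cong>\<^sub>n F"
proof -
  have sub: "intersection \<subseteq> space_of E" "intersection \<subseteq> space_of F" using EF inter_eq by auto
  have diff: "x - y \<in> intersection" if "x \<in> intersection" "y \<in> intersection" for x y
    using that normed_diff_mem[OF normed, of X] normed_diff_mem[OF normed, of Y] by auto
  obtain c where c: "0 < c" "\<And>z. z \<in> intersection \<Longrightarrow> norm_of E z = c * norm_of F z"
    using ratio by (auto simp: proportional_on_def)
  then have c': "0 < 1 / c" "\<And>z. z \<in> intersection \<Longrightarrow> norm_of F z = 1 / c * norm_of E z" by simp_all
  have 1: "x \<in> space_of F \<and> norm_of E x = c * norm_of F x" if "x \<in> space_of E" for x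
  proof (rule proportional_extend_subset[OF normed[OF EF(1)] banach[OF EF(2)] _ dense(1) sub c _ that])
    show "x = y" if "norm_lim E u x" "norm_lim F u y" for u x y by (rule compatible[OF EF that])
  qed (use diff in auto)
  have 2: "x \<in> space_of E \<and> norm_of F x = 1 / c * norm_of E x" if "x \<in> space_of F" for x
  proof (rule proportional_extend_subset[OF normed[OF EF(2)] banach[OF EF(1)] _ dense(2) sub(2,1) c' _ that])
    show "x = y" if "norm_lim F u x" "norm_lim E u y" for u x y by (rule compatible[OF EF(2,1) that])
  qed (use diff in auto)
  show ?thesis
    unfolding norm_proportional_def
  proof (intro conjI exI[of _ c] ballI)
    show "space_of E = space_of F" using 1 2 by blast
    show "norm_of E x = c * norm_of F x" if "x \<in> space_of E" for x using 1[OF that] by blast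
  qed (fact c(1))
qed

text \<open>
  Since \<open>f\<close> vanishes on \<open>Y\<close>, the operators \<open>w \<mapsto> f w z\<close> with \<open>z \<in> X\<close> belong to the couple. They map \<open>v\<close> to
  a nonzero multiple of \<open>z\<close>, hence \<open>X \<subseteq> V\<close>. If \<open>f\<close> did not vanish on \<open>W\<close>, then \<open>X \<subseteq> W\<close> for the same reason,
  and \<open>X \<subseteq> V \<inter> W = X \<inter> Y\<close> would lie in the kernel of \<open>f\<close>. So \<open>f\<close> vanishes on \<open>W\<close>, the roles of the
  couples can be exchanged, and the operator norms are now single products, one for \<open>X\<close> and one for \<open>V\<close>.
\<close>

lemma proportional_of_annihilator:
  assumes f: "couple_functional s X Y f" and fY: "\<And>y. y \<in> space_of Y \<Longrightarrow> f y = 0"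
    and x: "x \<in> space_of X" "f x \<noteq> 0" and v: "v \<in> space_of V" "f v \<noteq> 0"
  shows "X \<cong>\<^sub>n V"
proof -
  have N: "normed_space s X" "normed_space s Y" "normed_space s V" "normed_space s W"
    by (auto intro: normed)
  have lin: "linear_functional_on s (space_of E) f" if "E \<in> {X, Y, V, W}" for E
    by (rule couple_functional_linear[OF f that])
  have f': "linear_functional_on s (space_of (couple_sum X Y)) f" "bounded_functional X f"
    "bounded_functional Y f"
    using f by (simp_all add: couple_functional_def)
  have admXY: "admissible X f z" "admissible Y f z" if "z \<in> space_of X" for z
    using that fY f'(2,3) by (auto simp: admissible_def)
  have tr: "admissible V f z" "admissible W f z"
    "max (dual_norm X f * norm_of X z) (dual_norm Y f * norm_of Y z) =
     max (dual_norm V f * norm_of V z) (dual_norm W f * norm_of W z)"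
    if "z \<in> space_of X" "z \<noteq> 0" for z
    using rank_one_transfer[OF f'(1) couple_sum_left[OF N(1,2) that(1)] that(2) admXY[OF that(1)]] by auto
  have XV: "z \<in> space_of V" if "z \<in> space_of X" for z
    using tr(1)[OF that] v normed_zero_mem[OF N(3)] by (cases "z = 0") (auto simp: admissible_def)
  have fW: "f w = 0" if w: "w \<in> space_of W" for w
  proof (rule ccontr)
    assume "f w \<noteq> 0"
    moreover have "x \<noteq> 0" using x linear_functional_zero[OF lin normed_zero_mem[OF N(1)]] by auto
    ultimately have "x \<in> space_of W" using tr(2)[OF x(1)] w by (auto simp: admissible_def)
    then have "x \<in> space_of Y" using XV[OF x(1)] inter_eq by blast
    then show False using fY x(2) by blast
  qed
  have "x \<noteq> 0" using x linear_functional_zero[OF lin normed_zero_mem[OF N(1)]] by auto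
  then have bd: "bounded_functional V f" "bounded_functional W f"
    using tr(1,2)[OF x(1)] by (simp_all add: admissible_def)
  have VX: "z \<in> space_of X" if z: "z \<in> space_of V" for z
  proof (cases "z = 0")
    case True
    then show ?thesis using normed_zero_mem[OF N(1)] by simp
  next
    case False
    have "admissible X f z"
      using same_operators.rank_one_transfer(1)[OF swap_couples _ _ False] f'(1) z fW bd
        couple_sum_left[OF N(3,4) z] by (auto simp: sum_eq admissible_def)
    then show ?thesis using x by (auto simp: admissible_def)
  qed
  have zero: "dual_norm Y f = 0" "dual_norm W f = 0"
    using dual_norm_eq_0[OF N(2) lin f'(3)] dual_norm_eq_0[OF N(4) lin bd(2)] fY fW by simp_all
  have nonzero: "0 < dual_norm X f" "0 < dual_norm V f"
    using dual_norm_eq_0[OF N(1) lin f'(2)] dual_norm_eq_0[OF N(3) lin bd(1)]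
      dual_norm_nonneg[OF N(1) lin f'(2)] dual_norm_nonneg[OF N(3) lin bd(1)] x v
    by (auto simp: less_le)
  have eq: "norm_of X z = dual_norm V f / dual_norm X f * norm_of V z" if "z \<in> space_of X" for z
  proof (cases "z = 0")
    case True
    then show ?thesis using normed_norm_0 N by simp
  next
    case False
    then show ?thesis
      using tr(3)[OF that] zero nonzero normed_nonneg[OF N(1)] normed_nonneg[OF N(3)]
      by (simp add: field_simps max_absorb1)
  qed
  then have "proportional_on (space_of X) (norm_of X) (norm_of V)"
    using nonzero unfolding proportional_on_def by (intro exI[of _ "dual_norm V f / dual_norm X f"]) auto
  then show ?thesis using XV VX by (auto simp: norm_proportional_iff)
qed

text \<open>
  The quotient seminorm modulo \<open>Y\<close> does not vanish at a point of \<open>X\<close> that has positive distance in \<open>X\<close>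
  from the intersection, so that Hahn--Banach provides an annihilator of \<open>Y\<close> as required above. It
  is nonzero on \<open>X + Y = V + W\<close>, hence on \<open>V\<close> or on \<open>W\<close>.
\<close>

lemma proportional_of_not_dense:
  assumes "\<not> dense_in X intersection"
  shows "X \<cong>\<^sub>n V \<or> X \<cong>\<^sub>n W"
proof -
  have N: "normed_space s X" "normed_space s Y" "normed_space s V" "normed_space s W"
    by (auto intro: normed)
  obtain x e where x: "x \<in> space_of X" and e: "0 < e"
    and far: "\<And>d. d \<in> intersection \<Longrightarrow> e \<le> norm_of X (x - d)"
    using assms by (force simp: dense_in_def not_less)
  let ?q = "decomposition_norm 1 0 X Y"
  note q_le = decomposition_norm_le[OF N(1,2) zero_le_one order_refl]
  note memX = couple_sum_left[OF N(1,2)] and memY = couple_sum_right[OF N(1,2)]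
  obtain f where f: "linear_functional_on s (space_of (couple_sum X Y)) f"
    "\<And>w. w \<in> space_of (couple_sum X Y) \<Longrightarrow> norm (f w) \<le> ?q w" "?q x \<le> norm (f x)"
    using hahn_banach[OF subspace_couple_sum[OF N(1,2)]
        seminorm_decomposition[OF N(1,2) zero_le_one order_refl] memX[OF x]] by blast
  have fX: "norm (f z) \<le> 1 * norm_of X z" if "z \<in> space_of X" for z
    using f(2)[OF memX[OF that]] q_le[OF that normed_zero_mem[OF N(2)]] by simp
  have fY: "f z = 0" if "z \<in> space_of Y" for z
  proof -
    have "?q z \<le> 0"
      using q_le[OF normed_zero_mem[OF N(1)] that] normed_norm_0[OF N(1)] by simp
    then have "norm (f z) \<le> 0" using f(2)[OF memY[OF that]] by (rule order_trans[rotated])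
    then show ?thesis by simp
  qed
  have "e \<le> ?q x"
  proof (rule decomposition_norm_greatest[OF N(1,2) zero_le_one order_refl memX[OF x]])
    fix x' y assume d: "x' \<in> space_of X" "y \<in> space_of Y" "x = x' + y"
    then have "y = x - x'" by simp
    then have "y \<in> intersection" using d x normed_diff_mem[OF N(1)] by blast
    then show "e \<le> 1 * norm_of X x' + 0 * norm_of Y y" using far[of y] d by simp
  qed
  then have fx: "f x \<noteq> 0" using f(3) e by auto
  have cf: "couple_functional s X Y f"
    using f(1) fX fY by (auto simp: couple_functional_def bounded_functional_def
        intro: exI[of _ 1] exI[of _ 0])
  obtain v w where vw: "v \<in> space_of V" "w \<in> space_of W" "x = v + w"
    using memX[OF x] by (auto simp: sum_eq mem_couple_sum)
  have "f x = f v + f w"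
    using f(1) vw couple_sum_left[OF N(3,4)] couple_sum_right[OF N(3,4)]
    by (auto simp: linear_functional_on_def sum_eq)
  then consider "f v \<noteq> 0" | "f w \<noteq> 0" using fx by (cases "f v = 0") auto
  then show ?thesis
  proof cases
    case 1
    then show ?thesis using proportional_of_annihilator[OF cf fY x fx vw(1)] by blast
  next
    case 2
    then show ?thesis
      using same_operators.proportional_of_annihilator[OF swap_right cf fY x fx vw(2)] by blast
  qed
qed

lemma intersection_matching:
  "(proportional_on intersection (norm_of X) (norm_of V) \<and> proportional_on intersection (norm_of Y) (norm_of W)) \<or>
   (proportional_on intersection (norm_of X) (norm_of W) \<and> proportional_on intersection (norm_of Y) (norm_of V))"
proof (cases "\<exists>z0\<in>intersection. z0 \<noteq> 0")
  case False
  have "norm_of E z = 0" if "z \<in> intersection" "E \<in> {X, Y, V, W}" for z E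
  proof -
    have "z = 0" using False that(1) by blast
    then show ?thesis using normed_norm_0[OF normed[OF that(2)]] by simp
  qed
  then show ?thesis by (auto simp: proportional_on_def intro!: exI[of _ 1])
next
  case True
  then obtain z0 where z0: "z0 \<in> intersection" "z0 \<noteq> 0" by blast
  have z0': "z0 \<in> space_of Y \<inter> space_of X" "z0 \<in> space_of V \<inter> space_of W" "z0 \<in> space_of W \<inter> space_of V"
    using z0 inter_eq by auto
  have N: "normed_space s X" "normed_space s Y" "normed_space s V" "normed_space s W"
    by (auto intro: normed)
  obtain a b where ab: "0 \<le> a" "0 \<le> b"
    "\<And>z. z \<in> intersection \<Longrightarrow> norm_of X z = max (a * norm_of V z) (b * norm_of W z)"
    using same_operators.right_norm_is_max[OF swap_left z0'(1) z0(2)] by (metis Int_commute)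
  obtain a' b' where ab': "0 \<le> a'" "0 \<le> b'"
    "\<And>z. z \<in> intersection \<Longrightarrow> norm_of Y z = max (a' * norm_of V z) (b' * norm_of W z)"
    using right_norm_is_max[OF z0] by metis
  obtain c d where cd: "0 \<le> c" "0 \<le> d"
    "\<And>z. z \<in> intersection \<Longrightarrow> norm_of V z = max (c * norm_of X z) (d * norm_of Y z)"
    using same_operators.right_norm_is_max[OF same_operators.swap_left[OF swap_couples] z0'(3) z0(2)]
    by (metis Int_commute inter_eq)
  obtain c' d' where cd': "0 \<le> c'" "0 \<le> d'"
    "\<And>z. z \<in> intersection \<Longrightarrow> norm_of W z = max (c' * norm_of X z) (d' * norm_of Y z)"
    using same_operators.right_norm_is_max[OF swap_couples z0'(2) z0(2)] by (metis inter_eq)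
  have ext: "proportional_on intersection (norm_of E) (norm_of F)"
    if r: "proportional_on (intersection - {0}) (norm_of E) (norm_of F)"
      and EF: "E \<in> {X, Y, V, W}" "F \<in> {X, Y, V, W}" for E F
  proof -
    obtain c where c: "0 < c" "\<And>z. z \<in> intersection - {0} \<Longrightarrow> norm_of E z = c * norm_of F z"
      using r by (auto simp: proportional_on_def)
    have "norm_of E z = c * norm_of F z" if "z \<in> intersection" for z
      using c(2)[of z] that normed_norm_0[OF normed] EF by (cases "z = 0") simp_all
    with c(1) show ?thesis by (auto simp: proportional_on_def)
  qed
  have "(proportional_on (intersection - {0}) (norm_of X) (norm_of V) \<and>
      proportional_on (intersection - {0}) (norm_of Y) (norm_of W)) \<or>
    (proportional_on (intersection - {0}) (norm_of X) (norm_of W) \<and>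
      proportional_on (intersection - {0}) (norm_of Y) (norm_of V))"
  proof (rule matching_of_mutual_max[OF _ ab(1,2) ab'(1,2)])
    show "0 < norm_of X z \<and> 0 < norm_of Y z \<and> 0 < norm_of V z \<and> 0 < norm_of W z"
      if "z \<in> intersection - {0}" for z
      using that inter_eq normed_pos N by auto
  qed (use ab(3) ab'(3) cd(3) cd'(3) in blast)+
  then show ?thesis using ext by blast
qed

lemma dense_if_proportional:
  assumes EF: "E \<cong>\<^sub>n F" and dense: "dense_in E D" and D: "D \<subseteq> space_of E"
    and E: "normed_space s E"
  shows "dense_in F D"
  unfolding dense_in_def
proof (intro ballI allI impI)
  fix x and e :: real assume x: "x \<in> space_of F" and e: "0 < e"
  obtain c where c: "0 < c" "\<And>z. z \<in> space_of E \<Longrightarrow> norm_of E z = c * norm_of F z"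
    using EF by (auto simp: norm_proportional_def)
  have xE: "x \<in> space_of E" using x EF by (simp add: norm_proportional_def)
  obtain d where d: "d \<in> D" "norm_of E (x - d) < c * e"
    using dense xE mult_pos_pos[OF c(1) e] unfolding dense_in_def by blast
  have "x - d \<in> space_of E" using normed_diff_mem[OF E xE] d(1) D by blast
  then show "\<exists>d\<in>D. norm_of F (x - d) < e" using c d by auto
qed

lemma dense_if_subset:
  assumes "E \<in> {X, Y, V, W}" "space_of E \<subseteq> intersection"
  shows "dense_in E intersection"
  using assms normed_norm_0[OF normed[OF assms(1)]]
  by (force simp: dense_in_def)

text \<open>
  If \<open>W\<close> did not contain the intersection densely, it would be proportional to \<open>X\<close> or to \<open>Y\<close>. In the
  first case \<open>X\<close>, \<open>V\<close> and \<open>W\<close> would all coincide with the intersection, so that it would be dense in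
  \<open>X\<close>; the second case contradicts density in \<open>Y\<close>. Hence the norms of \<open>Y\<close> and \<open>W\<close> need to be compared
  on the intersection only. If the matching there pairs \<open>X\<close> with \<open>W\<close> and \<open>Y\<close> with \<open>V\<close>, the
  proportionality of \<open>X\<close> and \<open>V\<close> makes all four norms proportional.
\<close>

lemma matching_if_right_dense:
  assumes XV: "X \<cong>\<^sub>n V" and nX: "\<not> dense_in X intersection" and Y: "dense_in Y intersection"
  shows "Y \<cong>\<^sub>n W"
proof -
  have "dense_in W intersection"
  proof (rule ccontr)
    assume nW: "\<not> dense_in W intersection"
    then have "W \<cong>\<^sub>n X \<or> W \<cong>\<^sub>n Y"
      using same_operators.proportional_of_not_dense[OF same_operators.swap_left[OF swap_couples]]
      by (simp add: inter_eq Int_commute)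
    then show False
    proof
      assume "W \<cong>\<^sub>n X"
      then have "space_of X \<subseteq> intersection"
        using XV inter_eq by (auto simp: norm_proportional_def)
      then show False using dense_if_subset nX by blast
    next
      assume "W \<cong>\<^sub>n Y"
      then show False using dense_if_proportional[OF norm_proportional_sym Y _ normed] nW by blast
    qed
  qed
  moreover have "proportional_on intersection (norm_of X) (norm_of V)"
    using XV by (auto simp: norm_proportional_def proportional_on_def)
  then have "proportional_on intersection (norm_of Y) (norm_of W)"
    using intersection_matching proportional_on_sym proportional_on_trans by blast
  ultimately show ?thesis using Y by (intro proportional_extend) auto
qed

lemma matching_if_left_not_dense:
  assumes nX: "\<not> dense_in X intersection"
  shows "(X \<cong>\<^sub>n V \<and> Y \<cong>\<^sub>n W) \<or> (X \<cong>\<^sub>n W \<and> Y \<cong>\<^sub>n V)"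
proof (cases "dense_in Y intersection")
  case True
  then show ?thesis
    using proportional_of_not_dense[OF nX] matching_if_right_dense[OF _ nX True]
      same_operators.matching_if_right_dense[OF swap_right _ nX True] by blast
next
  case False
  then have "Y \<cong>\<^sub>n V \<or> Y \<cong>\<^sub>n W"
    using same_operators.proportional_of_not_dense[OF swap_left] by (simp add: Int_commute)
  moreover have "\<not> X \<cong>\<^sub>n Y"
    using nX dense_if_subset[of X] by (auto simp: norm_proportional_def)
  ultimately show ?thesis
    using proportional_of_not_dense[OF nX] norm_proportional_sym norm_proportional_trans by blast
qed

theorem couples_proportional: "(X \<cong>\<^sub>n V \<and> Y \<cong>\<^sub>n W) \<or> (X \<cong>\<^sub>n W \<and> Y \<cong>\<^sub>n V)"
proof -
  note left = same_operators.matching_if_left_not_dense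
  consider "\<not> dense_in X intersection" | "\<not> dense_in Y intersection"
    | "\<not> dense_in V intersection" | "\<not> dense_in W intersection"
    | "dense_in X intersection" "dense_in Y intersection" "dense_in V intersection" "dense_in W intersection"
    by blast
  then show ?thesis
  proof cases
    case 1
    then show ?thesis by (rule matching_if_left_not_dense)
  next
    case 2
    then show ?thesis using left[OF swap_left] by (auto simp: Int_commute)
  next
    case 3
    then show ?thesis using left[OF swap_couples] by (auto simp: inter_eq intro: norm_proportional_sym)
  next
    case 4
    then show ?thesis using left[OF same_operators.swap_left[OF swap_couples]]
      by (auto simp: inter_eq Int_commute intro: norm_proportional_sym)
  next
    case 5
    then show ?thesis using intersection_matching proportional_extend by blast
  qed
qed

end

theorem corollary3p8:
  fixes sR :: "real \<Rightarrow> 'a::ab_group_add \<Rightarrow> 'a" and X Y V W :: "'a nspace"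
    and sC :: "complex \<Rightarrow> 'b::ab_group_add \<Rightarrow> 'b" and X' Y' V' W' :: "'b nspace"
  shows
    "(vector_space sR \<and> banach_couple sR X Y \<and> banach_couple sR V W \<and> Int1 sR X Y = Int1 sR V W
        \<longrightarrow> (X \<cong>\<^sub>n V \<and> Y \<cong>\<^sub>n W) \<or> (X \<cong>\<^sub>n W \<and> Y \<cong>\<^sub>n V)) \<and>
     (vector_space sC \<and> banach_couple sC X' Y' \<and> banach_couple sC V' W' \<and> Int1 sC X' Y' = Int1 sC V' W'
        \<longrightarrow> (X' \<cong>\<^sub>n V' \<and> Y' \<cong>\<^sub>n W') \<or> (X' \<cong>\<^sub>n W' \<and> Y' \<cong>\<^sub>n V'))"
proof (intro conjI impI; elim conjE)
  assume "vector_space sR" and c: "banach_couple sR X Y" "banach_couple sR V W" "Int1 sR X Y = Int1 sR V W"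
  then interpret hahn_banach_space sR by (intro real_hahn_banach_space)
  show "(X \<cong>\<^sub>n V \<and> Y \<cong>\<^sub>n W) \<or> (X \<cong>\<^sub>n W \<and> Y \<cong>\<^sub>n V)"
    by (rule same_operators.couples_proportional[OF same_operators_of_Int1_eq[OF c]])
next
  assume "vector_space sC" and c: "banach_couple sC X' Y'" "banach_couple sC V' W'"
    "Int1 sC X' Y' = Int1 sC V' W'"
  then interpret hahn_banach_space sC by (intro complex_hahn_banach_space)
  show "(X' \<cong>\<^sub>n V' \<and> Y' \<cong>\<^sub>n W') \<or> (X' \<cong>\<^sub>n W' \<and> Y' \<cong>\<^sub>n V')"
    by (rule same_operators.couples_proportional[OF same_operators_of_Int1_eq[OF c]])
qed

end
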